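(* Let $n\ge 0$ and $R_n=\mathbb{Q}[x_1,\dots,x_n]$. The ideal $\langle P_\alpha : \alpha \text{ a non-empty composition of length } \ell(\alpha)\le n\rangle\subseteq R_n$ is equal to the vanishing ideal $\mathbf{I}(\mathrm{QSV}_n)$, and $$\langle \mathrm{QSym}_n^{+}\rangle = \mathsf{gr}\big(\mathbf{I}(\mathrm{QSV}_n)\big).$$
   Context: Compositions. A composition is a sequence of positive integers $\alpha=(\alpha_1,\dots,\alpha_k)$ of length $\ell(\alpha)=k$. For compositions $\alpha=(\alpha_1,\dots,\alpha_k)$, $\beta=(\beta_1,\dots,\beta_\ell)$, write $\beta\succeq\alpha$ ($\alpha$ refines $\beta$) if there is a (necessarily unique) sequence $1=f_1<f_2<\cdots<f_{\ell+1}=k+1$ with $\beta_i=\alpha_{f_i}+\alpha_{f_i+1}+\cdots+\alpha_{f_{i+1}-1}$ for all $i$. Polynomials. For a non-empty composition $\alpha$ of length $k$, $M_\alpha=\sum_{1\le i_1<\cdots<i_k\le n}x_{i_1}^{\alpha_1}\cdots x_{i_k}^{\alpha_k}\in R_n$ is the monomial quasisymmetric polynomial. The positive-degree quasisymmetric polynomials $\mathrm{QSym}_n^{+}$ are the $\mathbb{Q}$-span of the $M_\alpha$ with $\alpha$ non-empty and $\ell(\alpha)\le n$; $\langle\mathrm{QSym}_n^{+}\rangle$ is the ideal they generate in $R_n$. Define $$P_\alpha=\sum_{\beta\succeq\alpha}\ \sum_{1\le i_1<i_2<\cdots<i_\ell\le n}\ \prod_{j=1}^{\ell}\Big(\big(x_{i_j}^{\alpha_{f_j}}-i_j^{\alpha_{f_j}}\big)\prod_{s=f_j+1}^{f_{j+1}-1}\big(-\,i_j^{\alpha_s}\big)\Big)\in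 R_n,$$ where for each $\beta\succeq\alpha$, $\ell$ is the length of $\beta$ and $f_1,\dots,f_{\ell+1}$ is the sequence from the refinement relation. For $f\in R_n$, $\mathsf{h}(f)$ is the top-degree homogeneous component of $f$, and for an ideal $I\subseteq R_n$, $\mathsf{gr}(I)=\langle\mathsf{h}(f): f\in I\rangle$. The set $\mathrm{QSV}_n$. A noncrossing partition of size $n$ is a set $\lambda$ of arcs $(i,j)$, $1\le i<j\le n$, such that there are no two distinct arcs $(i,k),(j,l)\in\lambda$ with $i\le j<k\le l$. The connected components of $\lambda$ are those of the graph on $[n]=\{1,\dots,n\}$ whose edges are the arcs. The permutation $Q_\lambda\in S_n$ is defined by $Q_\lambda(j)=i$ if there is an arc $(i,j)\in\lambda$ with right endpoint $j$, and otherwise $Q_\lambda(j)$ is the largest element of the connected component of $j$. $\mathrm{QSV}_n=\{Q_\lambda:\lambda\text{ a noncrossing partition of size }n\}\subseteq S_n$, regarded as a set of points of $\mathbb{Q}^n$ by identifying $\sigma\in S_n$ with $(\sigma(1),\dots,\sigma(n))$. $\mathbf{I}(\mathrm{QSV}_n)\subseteq R_n$ is the ideal of polynomials vanishing at all these points. *)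

theory Defs
  imports Complex_Main "HOL-Library.Poly_Mapping" "HOL-Algebra.Ideal"
begin

section \<open>The polynomial ring \<open>R\<^sub>n\<close>\<close>

text \<open>
  A polynomial over \<open>\<rat>\<close> in variables indexed by the natural numbers is a finitely supported map
  from monomials (finitely supported exponent vectors) to coefficients. The ring \<open>R\<^sub>n\<close> consists of
  those that only involve \<open>x\<^sub>1, \<dots>, x\<^sub>n\<close>; ideals are ideals of this ring, not of the ring in
  infinitely many variables.
\<close>

type_synonym mpoly = "(nat \<Rightarrow>\<^sub>0 nat) \<Rightarrow>\<^sub>0 rat"

definition Var :: "nat \<Rightarrow> mpoly" where
  "Var i = Poly_Mapping.single (Poly_Mapping.single i 1) 1"

definition scale :: "rat \<Rightarrow> mpoly \<Rightarrow> mpoly" where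
  "scale c p = Poly_Mapping.single 0 c * p"

definition poly_carrier :: "nat \<Rightarrow> mpoly set" where
  "poly_carrier n = {p. \<forall>m \<in> Poly_Mapping.keys p. Poly_Mapping.keys m \<subseteq> {1..n}}"

definition R :: "nat \<Rightarrow> mpoly ring" where
  "R n = \<lparr>carrier = poly_carrier n, mult = (*), one = 1, zero = 0, add = (+)\<rparr>"

definition eval :: "(nat \<Rightarrow> rat) \<Rightarrow> mpoly \<Rightarrow> rat" where
  "eval a p = (\<Sum>m \<in> Poly_Mapping.keys p.
     Poly_Mapping.lookup p m * (\<Prod>i \<in> Poly_Mapping.keys m. a i ^ Poly_Mapping.lookup m i))"

definition mon_degree :: "(nat \<Rightarrow>\<^sub>0 nat) \<Rightarrow> nat" where
  "mon_degree m = (\<Sum>i \<in> Poly_Mapping.keys m. Poly_Mapping.lookup m i)"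

definition hom_component :: "nat \<Rightarrow> mpoly \<Rightarrow> mpoly" where
  "hom_component d p =
     (\<Sum>m \<in> {m \<in> Poly_Mapping.keys p. mon_degree m = d}. Poly_Mapping.single m (Poly_Mapping.lookup p m))"

text \<open>For \<open>p = 0\<close> the maximum below is unspecified, but every homogeneous component is \<open>0\<close>.\<close>

definition top_component :: "mpoly \<Rightarrow> mpoly" where
  "top_component p = hom_component (Max (mon_degree ` Poly_Mapping.keys p)) p"

definition gr :: "nat \<Rightarrow> mpoly set \<Rightarrow> mpoly set" where
  "gr n I = genideal (R n) (top_component ` I)"


section \<open>Compositions and the two families of polynomials\<close>

definition composition :: "nat list \<Rightarrow> bool" where
  "composition \<alpha> \<longleftrightarrow> (\<forall>a \<in> set \<alpha>. 0 < a)"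

text \<open>
  Lists are indexed from \<open>0\<close>, so the breakpoints are those of the usual convention shifted down
  by one: \<open>f\<close> starts at \<open>0\<close> and ends at the length of \<open>\<alpha>\<close>, and block \<open>j\<close> of \<open>\<alpha>\<close> consists of the
  positions \<open>f\<^sub>j, \<dots>, f\<^sub>j\<^sub>+\<^sub>1 - 1\<close>.
\<close>

definition breakpoints :: "nat list \<Rightarrow> nat list \<Rightarrow> nat list \<Rightarrow> bool" where
  "breakpoints \<beta> \<alpha> f \<longleftrightarrow>
     length f = length \<beta> + 1 \<and> sorted_wrt (<) f \<and> f ! 0 = 0 \<and> f ! length \<beta> = length \<alpha> \<and>
     (\<forall>j < length \<beta>. \<beta> ! j = (\<Sum>s \<in> {f ! j ..< f ! (j + 1)}. \<alpha> ! s))"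

definition coarsens :: "nat list \<Rightarrow> nat list \<Rightarrow> bool"  (infix \<open>\<succeq>\<close> 50) where
  "\<beta> \<succeq> \<alpha> \<longleftrightarrow> composition \<beta> \<and> (\<exists>f. breakpoints \<beta> \<alpha> f)"

definition the_breakpoints :: "nat list \<Rightarrow> nat list \<Rightarrow> nat list" where
  "the_breakpoints \<beta> \<alpha> = (THE f. breakpoints \<beta> \<alpha> f)"

definition index_seqs :: "nat \<Rightarrow> nat \<Rightarrow> nat list set" where
  "index_seqs n l = {i. length i = l \<and> sorted_wrt (<) i \<and> set i \<subseteq> {1..n}}"

definition M :: "nat \<Rightarrow> nat list \<Rightarrow> mpoly" where
  "M n \<alpha> = (\<Sum>i \<in> index_seqs n (length \<alpha>). \<Prod>j < length \<alpha>. Var (i ! j) ^ (\<alpha> ! j))"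

definition QSym_plus :: "nat \<Rightarrow> mpoly set" where
  "QSym_plus n = module.span scale {M n \<alpha> | \<alpha>. composition \<alpha> \<and> \<alpha> \<noteq> [] \<and> length \<alpha> \<le> n}"

definition P :: "nat \<Rightarrow> nat list \<Rightarrow> mpoly" where
  "P n \<alpha> = (\<Sum>\<beta> \<in> {\<beta>. \<beta> \<succeq> \<alpha>}. \<Sum>i \<in> index_seqs n (length \<beta>).
     let f = the_breakpoints \<beta> \<alpha> in
     \<Prod>j < length \<beta>.
       (Var (i ! j) ^ (\<alpha> ! (f ! j)) - of_nat (i ! j) ^ (\<alpha> ! (f ! j))) *
       (\<Prod>s \<in> {f ! j + 1 ..< f ! (j + 1)}. - (of_nat (i ! j) ^ (\<alpha> ! s))))"


section \<open>Noncrossing partitions and \<open>QSV\<^sub>n\<close>\<close>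

definition noncrossing :: "nat \<Rightarrow> (nat \<times> nat) set \<Rightarrow> bool" where
  "noncrossing n \<Lambda> \<longleftrightarrow>
     (\<forall>(i, j) \<in> \<Lambda>. 1 \<le> i \<and> i < j \<and> j \<le> n) \<and>
     \<not> (\<exists>i j k l. (i, k) \<in> \<Lambda> \<and> (j, l) \<in> \<Lambda> \<and> (i, k) \<noteq> (j, l) \<and> i \<le> j \<and> j < k \<and> k \<le> l)"

definition arc_component :: "(nat \<times> nat) set \<Rightarrow> nat \<Rightarrow> nat set" where
  "arc_component \<Lambda> j = {k. (j, k) \<in> (\<Lambda> \<union> \<Lambda>\<inverse>)\<^sup>*}"

text \<open>
  Points outside \<open>{1..n}\<close> lie on no arc, hence form singleton components and are fixed by \<open>Q \<Lambda>\<close>.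
  This is the library convention for a permutation of \<open>{1..n}\<close>.
\<close>

definition Q :: "(nat \<times> nat) set \<Rightarrow> nat \<Rightarrow> nat" where
  "Q \<Lambda> j = (if \<exists>i. (i, j) \<in> \<Lambda> then THE i. (i, j) \<in> \<Lambda> else Max (arc_component \<Lambda> j))"

definition QSV :: "nat \<Rightarrow> (nat \<Rightarrow> nat) set" where
  "QSV n = {Q \<Lambda> | \<Lambda>. noncrossing n \<Lambda>}"

text \<open>
  A permutation \<open>\<sigma>\<close> is identified with the point \<open>(\<sigma>(1), \<dots>, \<sigma>(n))\<close>; the coordinates with other
  indices are irrelevant to elements of \<open>R n\<close>.
\<close>

definition vanishing_ideal :: "nat \<Rightarrow> (nat \<Rightarrow> nat) set \<Rightarrow> mpoly set" where
  "vanishing_ideal n S = {p \<in> carrier (R n). \<forall>\<sigma> \<in> S. eval (\<lambda>i. of_nat (\<sigma> i)) p = 0}"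


section \<open>Well-formedness of the definitions\<close>

lemma vector_space_scale: "vector_space scale"
  by standard
    (simp_all add: scale_def single_add distrib_left distrib_right mult_single flip: mult.assoc)

lemma poly_carrier_0: "0 \<in> poly_carrier n"
  by (simp add: poly_carrier_def)

lemma poly_carrier_1: "1 \<in> poly_carrier n"
  by (simp add: poly_carrier_def)

lemma poly_carrier_add: "p \<in> poly_carrier n \<Longrightarrow> q \<in> poly_carrier n \<Longrightarrow> p + q \<in> poly_carrier n"
  using Poly_Mapping.keys_add[of p q] by (force simp: poly_carrier_def)

lemma poly_carrier_uminus: "p \<in> poly_carrier n \<Longrightarrow> - p \<in> poly_carrier n"
  by (simp add: poly_carrier_def)

lemma poly_carrier_diff: "p \<in> poly_carrier n \<Longrightarrow> q \<in> poly_carrier n \<Longrightarrow> p - q \<in> poly_carrier n"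
  using poly_carrier_add[OF _ poly_carrier_uminus, of p n q] by simp

lemma poly_carrier_mult:
  assumes "p \<in> poly_carrier n" "q \<in> poly_carrier n"
  shows "p * q \<in> poly_carrier n"
proof -
  have "Poly_Mapping.keys m \<subseteq> {1..n}" if m: "m \<in> Poly_Mapping.keys (p * q)" for m
  proof -
    obtain a b where ab: "m = a + b" "a \<in> Poly_Mapping.keys p" "b \<in> Poly_Mapping.keys q"
      using Poly_Mapping.keys_mult[of p q] m by blast
    then show ?thesis
      using assms Poly_Mapping.keys_add[of a b] unfolding poly_carrier_def by blast
  qed
  then show ?thesis by (simp add: poly_carrier_def)
qed

lemma poly_carrier_power: "p \<in> poly_carrier n \<Longrightarrow> p ^ k \<in> poly_carrier n"
  by (induction k) (auto intro: poly_carrier_1 poly_carrier_mult)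

lemma poly_carrier_sum: "(\<And>x. x \<in> A \<Longrightarrow> f x \<in> poly_carrier n) \<Longrightarrow> sum f A \<in> poly_carrier n"
  by (induction A rule: infinite_finite_induct) (auto intro: poly_carrier_0 poly_carrier_add)

lemma poly_carrier_prod: "(\<And>x. x \<in> A \<Longrightarrow> f x \<in> poly_carrier n) \<Longrightarrow> prod f A \<in> poly_carrier n"
  by (induction A rule: infinite_finite_induct) (auto intro: poly_carrier_1 poly_carrier_mult)

lemma poly_carrier_of_nat: "of_nat k \<in> poly_carrier n"
  by (induction k) (auto intro: poly_carrier_0 poly_carrier_1 poly_carrier_add)

lemma poly_carrier_Var: "i \<in> {1..n} \<Longrightarrow> Var i \<in> poly_carrier n"
  by (simp add: poly_carrier_def Var_def)

lemma cring_R: "cring (R n)"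
proof (rule cringI)
  show "abelian_group (R n)"
  proof (rule abelian_groupI)
    fix p assume "p \<in> carrier (R n)"
    then show "\<exists>q \<in> carrier (R n). q \<oplus>\<^bsub>R n\<^esub> p = \<zero>\<^bsub>R n\<^esub>"
      by (intro bexI[of _ "- p"]) (auto simp: R_def poly_carrier_uminus)
  qed (auto simp: R_def poly_carrier_0 poly_carrier_add algebra_simps)
  show "comm_monoid (R n)"
    by (rule comm_monoidI) (auto simp: R_def poly_carrier_1 poly_carrier_mult algebra_simps)
qed (auto simp: R_def algebra_simps)

lemma index_seqs_nth: "i \<in> index_seqs n l \<Longrightarrow> j < l \<Longrightarrow> i ! j \<in> {1..n}"
  unfolding index_seqs_def using nth_mem by blast

lemma finite_index_seqs: "finite (index_seqs n l)"
  by (rule finite_subset[OF _ finite_lists_length_eq[of "{1..n}" l]]) (auto simp: index_seqs_def)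

lemma M_in_R: "M n \<alpha> \<in> carrier (R n)"
  unfolding M_def R_def
  by (auto intro!: poly_carrier_sum poly_carrier_prod poly_carrier_power poly_carrier_Var
      dest: index_seqs_nth)

lemma P_in_R: "P n \<alpha> \<in> carrier (R n)"
  unfolding P_def R_def Let_def
  by (auto intro!: poly_carrier_sum poly_carrier_prod poly_carrier_mult poly_carrier_diff
      poly_carrier_uminus poly_carrier_power poly_carrier_of_nat poly_carrier_Var
      dest: index_seqs_nth)

lemma breakpoints_le:
  assumes "breakpoints \<beta> \<alpha> f" "j \<le> length \<beta>"
  shows "f ! j \<le> length \<alpha>"
  using assms sorted_wrt_nth_less[of "(<)" f j "length \<beta>"]
  by (cases "j = length \<beta>") (auto simp: breakpoints_def)

lemma breakpoints_unique:
  assumes \<alpha>: "composition \<alpha>" and f: "breakpoints \<beta> \<alpha> f" and g: "breakpoints \<beta> \<alpha> g"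
  shows "f = g"
proof (rule nth_equalityI)
  show "length f = length g" using f g by (simp add: breakpoints_def)
next
  have inj: "b = c" if "(\<Sum>s \<in> {a..<b}. \<alpha> ! s) = (\<Sum>s \<in> {a..<c}. \<alpha> ! s)"
    and "a \<le> b" "a \<le> c" "b \<le> length \<alpha>" "c \<le> length \<alpha>" for a b c
  proof -
    have *: "\<not> b < c" if "(\<Sum>s \<in> {a..<b}. \<alpha> ! s) = (\<Sum>s \<in> {a..<c}. \<alpha> ! s)"
      and "a \<le> b" "c \<le> length \<alpha>" for b c
    proof
      assume "b < c"
      then have "0 < (\<Sum>s \<in> {b..<c}. \<alpha> ! s)"
        using \<alpha> \<open>c \<le> length \<alpha>\<close> by (intro sum_pos) (auto simp: composition_def)
      moreover have "(\<Sum>s \<in> {a..<c}. \<alpha> ! s) = (\<Sum>s \<in> {a..<b}. \<alpha> ! s) + (\<Sum>s \<in> {b..<c}. \<alpha> ! s)"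
        using \<open>a \<le> b\<close> \<open>b < c\<close> by (simp add: sum.atLeastLessThan_concat)
      ultimately show False using that(1) by simp
    qed
    show ?thesis using *[of b c] *[of c b] that by force
  qed
  have step: "f ! j \<le> f ! (j + 1)" "g ! j \<le> g ! (j + 1)" if "j < length \<beta>" for j
    using f g that sorted_wrt_nth_less[of "(<)" f j "j + 1"] sorted_wrt_nth_less[of "(<)" g j "j + 1"]
    by (auto simp: breakpoints_def)
  have "f ! j = g ! j" if "j \<le> length \<beta>" for j
    using that
  proof (induction j)
    case 0
    then show ?case using f g by (simp add: breakpoints_def)
  next
    case (Suc j)
    then have j: "j < length \<beta>" and eq: "f ! j = g ! j" by auto
    have "\<beta> ! j = (\<Sum>s \<in> {f ! j ..< f ! (j + 1)}. \<alpha> ! s)"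
      using f j unfolding breakpoints_def by blast
    moreover have "\<beta> ! j = (\<Sum>s \<in> {f ! j ..< g ! (j + 1)}. \<alpha> ! s)"
      using g j unfolding breakpoints_def eq by blast
    ultimately have "(\<Sum>s \<in> {f ! j ..< f ! (j + 1)}. \<alpha> ! s) = (\<Sum>s \<in> {f ! j ..< g ! (j + 1)}. \<alpha> ! s)"
      by (rule trans[OF sym])
    then have "f ! (j + 1) = g ! (j + 1)"
    proof (rule inj)
      show "f ! j \<le> f ! (j + 1)" "f ! j \<le> g ! (j + 1)" using step[OF j] eq by simp_all
      show "f ! (j + 1) \<le> length \<alpha>" "g ! (j + 1) \<le> length \<alpha>"
        using j breakpoints_le[OF f] breakpoints_le[OF g] by simp_all
    qed
    then show ?case by simp
  qed
  then show "f ! j = g ! j" if "j < length f" for j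
    using f that by (simp add: breakpoints_def)
qed

lemma breakpoints_the_breakpoints:
  assumes "composition \<alpha>" "\<beta> \<succeq> \<alpha>"
  shows "breakpoints \<beta> \<alpha> (the_breakpoints \<beta> \<alpha>)"
proof -
  obtain f where f: "breakpoints \<beta> \<alpha> f" using assms(2) by (auto simp: coarsens_def)
  show ?thesis
    unfolding the_breakpoints_def
    by (rule theI[of "breakpoints \<beta> \<alpha>", OF f]) (rule breakpoints_unique[OF assms(1) _ f])
qed

lemma finite_coarsenings: "finite {\<beta>. \<beta> \<succeq> \<alpha>}"
proof -
  define F where "F = {f. set f \<subseteq> {..length \<alpha>} \<and> length f \<le> length \<alpha> + 1}"
  define g where "g f = map (\<lambda>j. \<Sum>s \<in> {f ! j ..< f ! (j + 1)}. \<alpha> ! s) [0..<length f - 1]" for f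
  have "{\<beta>. \<beta> \<succeq> \<alpha>} \<subseteq> g ` F"
  proof
    fix \<beta> assume "\<beta> \<in> {\<beta>. \<beta> \<succeq> \<alpha>}"
    then obtain f where f: "breakpoints \<beta> \<alpha> f" by (auto simp: coarsens_def)
    have sub: "set f \<subseteq> {..length \<alpha>}"
      using f breakpoints_le[OF f] by (auto simp: breakpoints_def in_set_conv_nth)
    have "distinct f" using f by (auto simp: breakpoints_def strict_sorted_iff)
    then have "length f \<le> length \<alpha> + 1"
      using card_mono[OF _ sub] by (simp add: distinct_card)
    moreover have "g f = \<beta>"
      using f by (intro nth_equalityI) (auto simp: g_def breakpoints_def)
    ultimately show "\<beta> \<in> g ` F" using sub by (auto simp: F_def)
  qed
  moreover have "finite F" unfolding F_def by (rule finite_lists_length_le) simp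
  ultimately show ?thesis by (metis finite_imageI finite_subset)
qed

end

theory Submission
  imports Defs "HOL-Library.Function_Algebras"
begin

text \<open>
  With noncommuting letters, \<open>\<Sum> P\<^sub>\<alpha> y\<^sub>\<alpha>\<close> is the ordered product of \<open>X\<^sub>k N\<^sub>k\<^sup>-\<^sup>1\<close> for \<open>k = 1, \<dots>, n\<close>, where
  \<open>X\<^sub>k = 1 + \<Sum> x\<^sub>k\<^sup>a y\<^sub>a\<close> and \<open>N\<^sub>k = 1 + \<Sum> k\<^sup>a y\<^sub>a\<close>. At a point \<open>Q\<^sub>\<lambda>\<close> this product telescopes to \<open>1\<close> along the
  nested arcs of \<open>\<lambda>\<close>, so the \<open>P\<^sub>\<alpha>\<close> vanish on \<open>QSV\<^sub>n\<close>. Moreover \<open>P\<^sub>\<alpha>\<close> has top component \<open>M\<^sub>\<alpha>\<close>.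

  Call a monomial \<open>x\<^sup>e\<close> subdiagonal if \<open>e\<^sub>1 + \<dots> + e\<^sub>i < i\<close> for all \<open>i\<close>. The polynomials of Aval, Bergeron and
  Bergeron show that the subdiagonal monomials span \<open>R\<^sub>n\<close> modulo the \<open>M\<^sub>\<alpha>\<close>, compatibly with degrees, hence
  also modulo the \<open>P\<^sub>\<alpha>\<close>. There are at most as many of them as points of \<open>QSV\<^sub>n\<close>, and by interpolation they
  span all functions on \<open>QSV\<^sub>n\<close>. So they are independent as functions on \<open>QSV\<^sub>n\<close>, which leaves no room for
  elements of the vanishing ideal, or of its associated graded ideal, beyond the known ones.
\<close>

subsection \<open>Spans and monomials\<close>

text \<open>Why the P_alpha have their shape: X_k N_k^{-1} = 1 + (X_k - N_k) N_k^{-1}, and its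
  coefficient at a word a_1 ... a_r is (x_k^{a_1} - k^{a_1}) times the product of the -k^{a_s} with
  s >= 2, the factor of one block. At Q_lambda it becomes N_{Q(k)} N_k^{-1}; the letters do not
  commute, so factors joined by an arc cancel only after everything between them has, which is where
  noncrossing enters. The obstacle for the graded statement: a polynomial of degree d in the
  vanishing ideal could reduce, modulo the M_alpha, to a subdiagonal remainder that still has a part
  of degree d. Replacing M_alpha by P_alpha changes only lower degrees, so the remainder modulo the
  P_alpha has the same part of degree d, and that remainder is zero by independence. For this reason
  every reduction carries a degree bound. On the counting side an injection from subdiagonal
  monomials to noncrossing partitions is enough, since spanning bounds their number from below by
  that of the points.\<close>

interpretation mpoly: vector_space scale
  by (rule vector_space_scale)

abbreviation monomial :: "(nat \<Rightarrow>\<^sub>0 nat) \<Rightarrow> mpoly" where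
  "monomial m \<equiv> Poly_Mapping.single m 1"

lemma single_eq_scale: "Poly_Mapping.single m c = scale c (monomial m)"
  by (simp add: scale_def mult_single)

lemma scale_mult_right: "p * scale c q = scale c (p * q)"
  by (simp add: scale_def algebra_simps)

lemma lookup_scale: "Poly_Mapping.lookup (scale c p) m = c * Poly_Mapping.lookup p m"
  by (simp add: scale_def flip: mult_map_scale_conv_mult) (transfer, simp add: when_def)

lemma mpoly_sum_singles:
  "p = (\<Sum>m \<in> Poly_Mapping.keys p. Poly_Mapping.single m (Poly_Mapping.lookup p m))"
  for p :: "'a \<Rightarrow>\<^sub>0 'b::comm_monoid_add"
  by (rule poly_mapping_eqI)
    (simp add: lookup_sum lookup_single when_def in_keys_iff)

lemma mpoly_in_span_monomials: "p \<in> mpoly.span (monomial ` Poly_Mapping.keys p)"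
proof -
  have "(\<Sum>m \<in> Poly_Mapping.keys p. scale (Poly_Mapping.lookup p m) (monomial m))
      \<in> mpoly.span (monomial ` Poly_Mapping.keys p)"
    by (intro mpoly.span_sum mpoly.span_scale mpoly.span_base) auto
  then show ?thesis
    using mpoly_sum_singles[of p] by (simp add: single_eq_scale[of _ "Poly_Mapping.lookup p _"])
qed

lemma monomial_add: "monomial (m + m') = monomial m * monomial m'"
  by (simp add: mult_single)

lemma Var_eq_monomial: "Var i = monomial (Poly_Mapping.single i 1)"
  by (simp add: Var_def)

subsection \<open>Polynomials in a range of variables\<close>

text \<open>Generalises \<open>poly_carrier\<close>, because the recursions below peel off x_k and
  leave polynomials in x_{k+1}, ..., x_n.\<close>

definition vars_in :: "nat set \<Rightarrow> mpoly set" where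
  "vars_in V = {p. \<forall>m \<in> Poly_Mapping.keys p. Poly_Mapping.keys m \<subseteq> V}"

lemma poly_carrier_eq_vars_in: "poly_carrier n = vars_in {1..n}"
  by (simp add: poly_carrier_def vars_in_def)

lemma vars_in_mono: "V \<subseteq> W \<Longrightarrow> vars_in V \<subseteq> vars_in W"
  unfolding vars_in_def by blast

lemma vars_in_0 [simp]: "0 \<in> vars_in V"
  and vars_in_1 [simp]: "1 \<in> vars_in V"
  by (simp_all add: vars_in_def)

lemma vars_in_Var: "i \<in> V \<Longrightarrow> Var i \<in> vars_in V"
  by (simp add: vars_in_def Var_def)

lemma vars_in_add: "p \<in> vars_in V \<Longrightarrow> q \<in> vars_in V \<Longrightarrow> p + q \<in> vars_in V"
  using Poly_Mapping.keys_add[of p q] by (force simp: vars_in_def)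

lemma vars_in_diff: "p \<in> vars_in V \<Longrightarrow> q \<in> vars_in V \<Longrightarrow> p - q \<in> vars_in V"
  using vars_in_add[of p V "- q"] by (simp add: vars_in_def)

lemma vars_in_mult:
  assumes "p \<in> vars_in V" "q \<in> vars_in V"
  shows "p * q \<in> vars_in V"
  unfolding vars_in_def
proof (intro CollectI ballI)
  fix m assume "m \<in> Poly_Mapping.keys (p * q)"
  then obtain a b where ab: "m = a + b" "a \<in> Poly_Mapping.keys p" "b \<in> Poly_Mapping.keys q"
    using Poly_Mapping.keys_mult[of p q] by blast
  then show "Poly_Mapping.keys m \<subseteq> V"
    using assms Poly_Mapping.keys_add[of a b] unfolding vars_in_def by blast
qed

lemma vars_in_scale: "p \<in> vars_in V \<Longrightarrow> scale c p \<in> vars_in V"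
  unfolding scale_def by (rule vars_in_mult) (simp_all add: vars_in_def)

lemma poly_carrier_scale: "p \<in> poly_carrier n \<Longrightarrow> scale c p \<in> poly_carrier n"
  by (simp add: poly_carrier_eq_vars_in vars_in_scale)

lemma subspace_poly_carrier: "mpoly.subspace (poly_carrier n)"
  by (rule mpoly.subspaceI) (auto intro: poly_carrier_0 poly_carrier_add poly_carrier_scale)

subsection \<open>Degree\<close>

lemma mon_degree_eq_sum:
  assumes "finite A" "Poly_Mapping.keys m \<subseteq> A"
  shows "mon_degree m = (\<Sum>i \<in> A. Poly_Mapping.lookup m i)"
  unfolding mon_degree_def using assms
  by (intro sum.mono_neutral_left) (auto simp: in_keys_iff)

lemma mon_degree_add [simp]: "mon_degree (m + m') = mon_degree m + mon_degree m'"
proof -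
  let ?A = "Poly_Mapping.keys m \<union> Poly_Mapping.keys m'"
  have "mon_degree (m + m') = (\<Sum>i \<in> ?A. Poly_Mapping.lookup (m + m') i)"
    by (rule mon_degree_eq_sum) (use Poly_Mapping.keys_add[of m m'] in auto)
  moreover have "mon_degree m = (\<Sum>i \<in> ?A. Poly_Mapping.lookup m i)"
    "mon_degree m' = (\<Sum>i \<in> ?A. Poly_Mapping.lookup m' i)"
    by (rule mon_degree_eq_sum; auto)+
  ultimately show ?thesis by (simp add: lookup_add sum.distrib)
qed

lemma mon_degree_0 [simp]: "mon_degree 0 = 0"
  by (simp add: mon_degree_def)

lemma mon_degree_single [simp]: "mon_degree (Poly_Mapping.single i k) = k"
  by (simp add: mon_degree_def)

text \<open>A strict bound makes \<open>deg_lt 0\<close> the zero space, so "equal up to lower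
  degree" makes sense in degree 0 as well.\<close>

definition deg_lt :: "nat \<Rightarrow> mpoly set" where
  "deg_lt d = {p. \<forall>m \<in> Poly_Mapping.keys p. mon_degree m < d}"

lemma deg_lt_mono: "d \<le> e \<Longrightarrow> deg_lt d \<subseteq> deg_lt e"
  by (auto simp: deg_lt_def)

lemma zero_in_deg_lt [simp]: "0 \<in> deg_lt d"
  by (simp add: deg_lt_def)

lemma deg_lt_0_iff [simp]: "p \<in> deg_lt 0 \<longleftrightarrow> p = 0"
  by (auto simp: deg_lt_def simp flip: keys_eq_empty)

lemma monomial_in_deg_lt [simp]: "monomial m \<in> deg_lt d \<longleftrightarrow> mon_degree m < d"
  by (simp add: deg_lt_def)

lemma deg_lt_add: "p \<in> deg_lt d \<Longrightarrow> q \<in> deg_lt d \<Longrightarrow> p + q \<in> deg_lt d"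
  using Poly_Mapping.keys_add[of p q] by (force simp: deg_lt_def)

lemma deg_lt_uminus: "p \<in> deg_lt d \<Longrightarrow> - p \<in> deg_lt d"
  by (simp add: deg_lt_def)

lemma deg_lt_diff: "p \<in> deg_lt d \<Longrightarrow> q \<in> deg_lt d \<Longrightarrow> p - q \<in> deg_lt d"
  using deg_lt_add[of p d "- q"] by (simp add: deg_lt_uminus)

text \<open>The asymmetric bounds fit the typical use: a factor of degree at most \<open>d\<close>
  times an error term strictly below \<open>e\<close> is again an error term.\<close>

lemma deg_lt_mult:
  assumes "p \<in> deg_lt (Suc d)" "q \<in> deg_lt e" 
  shows "p * q \<in> deg_lt (d + e)"
  unfolding deg_lt_def
proof (intro CollectI ballI)
  fix m assume "m \<in> Poly_Mapping.keys (p * q)"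
  then obtain a b where "m = a + b" "a \<in> Poly_Mapping.keys p" "b \<in> Poly_Mapping.keys q"
    using Poly_Mapping.keys_mult[of p q] by blast
  then show "mon_degree m < d + e"
    using assms by (force simp: deg_lt_def)
qed

lemma const_in_deg_lt: "Poly_Mapping.single 0 c \<in> deg_lt (Suc d)"
  by (simp add: deg_lt_def)

lemma deg_lt_scale: "p \<in> deg_lt d \<Longrightarrow> scale c p \<in> deg_lt d"
  unfolding scale_def using deg_lt_mult[OF const_in_deg_lt[of c 0]] by simp

lemma subspace_deg_lt: "mpoly.subspace (deg_lt d)"
  by (rule mpoly.subspaceI) (auto intro: deg_lt_add deg_lt_scale)

lemma finite_monomials_of_degree:
  "finite {m. Poly_Mapping.keys m \<subseteq> {1..n} \<and> mon_degree m < d}" (is "finite ?S")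
proof -
  have "inj_on (\<lambda>m. map (Poly_Mapping.lookup m) [1..<Suc n]) ?S"
  proof (rule inj_onI)
    fix m m' assume m: "m \<in> ?S" and m': "m' \<in> ?S"
      and eq: "map (Poly_Mapping.lookup m) [1..<Suc n] = map (Poly_Mapping.lookup m') [1..<Suc n]"
    show "m = m'"
    proof (rule poly_mapping_eqI)
      fix i show "Poly_Mapping.lookup m i = Poly_Mapping.lookup m' i"
      proof (cases "i \<in> {1..n}")
        case True
        then show ?thesis using eq by auto
      next
        case False
        then have "i \<notin> Poly_Mapping.keys m" "i \<notin> Poly_Mapping.keys m'"
          using m m' by blast+
        then show ?thesis by (simp add: in_keys_iff)
      qed
    qed
  qed
  moreover have "(\<lambda>m. map (Poly_Mapping.lookup m) [1..<Suc n]) ` ?S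
    \<subseteq> {xs. set xs \<subseteq> {..<d} \<and> length xs = n}"
  proof -
    have "Poly_Mapping.lookup m i < d" if "mon_degree m < d" for m i
      using that member_le_sum[of i "Poly_Mapping.keys m" "Poly_Mapping.lookup m"]
      by (cases "i \<in> Poly_Mapping.keys m") (auto simp: mon_degree_def in_keys_iff)
    then show ?thesis by auto
  qed
  ultimately show ?thesis
    by (rule inj_on_finite) (simp add: finite_lists_length_eq)
qed

section \<open>Homogeneous polynomials and components\<close>

definition homogeneous :: "nat \<Rightarrow> mpoly set" where
  "homogeneous d = {p. \<forall>m \<in> Poly_Mapping.keys p. mon_degree m = d}"

lemma homogeneous_0 [simp]: "0 \<in> homogeneous d"
  and homogeneous_1 [simp]: "1 \<in> homogeneous 0"
  and homogeneous_monomial [simp]: "monomial m \<in> homogeneous d \<longleftrightarrow> mon_degree m = d"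
  by (simp_all add: homogeneous_def)

lemma homogeneous_add: "p \<in> homogeneous d \<Longrightarrow> q \<in> homogeneous d \<Longrightarrow> p + q \<in> homogeneous d"
  using Poly_Mapping.keys_add[of p q] by (force simp: homogeneous_def)

lemma homogeneous_mult: "p \<in> homogeneous d \<Longrightarrow> q \<in> homogeneous e \<Longrightarrow> p * q \<in> homogeneous (d + e)"
  using keys_mult[of p q] by (force simp: homogeneous_def)

lemma homogeneous_subset_deg_lt: "homogeneous d \<subseteq> deg_lt (Suc d)"
  by (auto simp: homogeneous_def deg_lt_def)

lemma lookup_hom_component:
  "Poly_Mapping.lookup (hom_component d p) m = (if mon_degree m = d then Poly_Mapping.lookup p m else 0)"
  by (auto simp: hom_component_def lookup_sum lookup_single when_def in_keys_iff sum.If_cases)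

lemma hom_component_add: "hom_component d (p + q) = hom_component d p + hom_component d q"
  and hom_component_scale: "hom_component d (scale c p) = scale c (hom_component d p)"
  and hom_component_0 [simp]: "hom_component d 0 = 0"
  by (rule poly_mapping_eqI; simp add: lookup_hom_component lookup_add lookup_scale)+

lemma hom_component_homogeneous: "p \<in> homogeneous d \<Longrightarrow> hom_component d p = p"
  by (rule poly_mapping_eqI) (auto simp: lookup_hom_component homogeneous_def in_keys_iff)

lemma hom_component_deg_lt: "p \<in> deg_lt d \<Longrightarrow> hom_component d p = 0"
  by (rule poly_mapping_eqI) (auto simp: lookup_hom_component deg_lt_def in_keys_iff)

lemma top_component_eq:
  assumes "p \<in> deg_lt (Suc d)" "hom_component d p \<noteq> 0"
  shows "top_component p = hom_component d p"
proof -
  obtain m where "Poly_Mapping.lookup (hom_component d p) m \<noteq> 0"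
    using assms(2) by (metis lookup_zero poly_mapping_eqI)
  then have "m \<in> Poly_Mapping.keys p" "mon_degree m = d"
    by (auto simp: lookup_hom_component in_keys_iff split: if_splits)
  then have "Max (mon_degree ` Poly_Mapping.keys p) = d"
    using assms(1) by (intro Max_eqI) (auto simp: deg_lt_def)
  then show ?thesis by (simp add: top_component_def)
qed

lemma hom_component_poly_carrier: "p \<in> poly_carrier n \<Longrightarrow> hom_component d p \<in> poly_carrier n"
  by (auto simp: poly_carrier_def in_keys_iff lookup_hom_component split: if_splits)

subsection \<open>Evaluation\<close>

definition eval_mon :: "(nat \<Rightarrow> rat) \<Rightarrow> (nat \<Rightarrow>\<^sub>0 nat) \<Rightarrow> rat" where
  "eval_mon a m = (\<Prod>i \<in> Poly_Mapping.keys m. a i ^ Poly_Mapping.lookup m i)"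

lemma eval_mon_eq_prod:
  assumes "finite A" "Poly_Mapping.keys m \<subseteq> A"
  shows "eval_mon a m = (\<Prod>i \<in> A. a i ^ Poly_Mapping.lookup m i)"
  unfolding eval_mon_def using assms
  by (intro prod.mono_neutral_left) (auto simp: in_keys_iff)

lemma eval_mon_add: "eval_mon a (m + m') = eval_mon a m * eval_mon a m'"
proof -
  let ?A = "Poly_Mapping.keys m \<union> Poly_Mapping.keys m'"
  have "eval_mon a (m + m') = (\<Prod>i \<in> ?A. a i ^ Poly_Mapping.lookup (m + m') i)"
    by (rule eval_mon_eq_prod) (use Poly_Mapping.keys_add[of m m'] in auto)
  moreover have "eval_mon a m = (\<Prod>i \<in> ?A. a i ^ Poly_Mapping.lookup m i)"
    "eval_mon a m' = (\<Prod>i \<in> ?A. a i ^ Poly_Mapping.lookup m' i)"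
    by (rule eval_mon_eq_prod; auto)+
  ultimately show ?thesis by (simp add: lookup_add prod.distrib power_add)
qed

lemma eval_eq_sum:
  assumes "finite A" "Poly_Mapping.keys p \<subseteq> A"
  shows "eval a p = (\<Sum>m \<in> A. Poly_Mapping.lookup p m * eval_mon a m)"
  unfolding eval_def eval_mon_def[symmetric] using assms
  by (intro sum.mono_neutral_left) (auto simp: in_keys_iff)

lemma eval_add [simp]: "eval a (p + q) = eval a p + eval a q"
proof -
  let ?A = "Poly_Mapping.keys p \<union> Poly_Mapping.keys q"
  have "eval a (p + q) = (\<Sum>m \<in> ?A. Poly_Mapping.lookup (p + q) m * eval_mon a m)"
    by (rule eval_eq_sum) (use Poly_Mapping.keys_add[of p q] in auto)
  moreover have "eval a p = (\<Sum>m \<in> ?A. Poly_Mapping.lookup p m * eval_mon a m)"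
    "eval a q = (\<Sum>m \<in> ?A. Poly_Mapping.lookup q m * eval_mon a m)"
    by (rule eval_eq_sum; auto)+
  ultimately show ?thesis by (simp add: lookup_add sum.distrib distrib_right)
qed

lemma eval_0 [simp]: "eval a 0 = 0"
  by (simp add: eval_def)

lemma eval_single: "eval a (Poly_Mapping.single m c) = c * eval_mon a m"
  by (cases "c = 0") (simp_all add: eval_def eval_mon_def)

lemma eval_uminus [simp]: "eval a (- p) = - eval a p"
  using eval_add[of a p "- p"] by (simp add: eq_neg_iff_add_eq_0 add.commute)

lemma eval_diff [simp]: "eval a (p - q) = eval a p - eval a q"
  using eval_add[of a p "- q"] by simp

lemma eval_sum [simp]: "eval a (sum f A) = (\<Sum>x \<in> A. eval a (f x))"
  by (induction A rule: infinite_finite_induct) simp_all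

lemma eval_mult [simp]: "eval a (p * q) = eval a p * eval a q"
proof -
  let ?s = "\<lambda>p m. Poly_Mapping.single m (Poly_Mapping.lookup p m)"
  have "p * q = (\<Sum>m \<in> Poly_Mapping.keys p. ?s p m) * (\<Sum>m \<in> Poly_Mapping.keys q. ?s q m)"
    by (simp flip: mpoly_sum_singles)
  then have "eval a (p * q) = (\<Sum>m \<in> Poly_Mapping.keys p. \<Sum>m' \<in> Poly_Mapping.keys q.
      eval a (?s p m) * eval a (?s q m'))"
    by (simp add: sum_product mult_single eval_single eval_mon_add mult_ac)
  also have "\<dots> = eval a (\<Sum>m \<in> Poly_Mapping.keys p. ?s p m) *
      eval a (\<Sum>m \<in> Poly_Mapping.keys q. ?s q m)"
    by (simp add: sum_product)
  finally show ?thesis by (simp flip: mpoly_sum_singles)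
qed

lemma eval_1 [simp]: "eval a 1 = 1"
  using eval_single[of a 0 1] by (simp add: eval_mon_def)

lemma eval_power [simp]: "eval a (p ^ k) = eval a p ^ k"
  by (induction k) simp_all

lemma eval_prod [simp]: "eval a (prod f A) = (\<Prod>x \<in> A. eval a (f x))"
  by (induction A rule: infinite_finite_induct) simp_all

lemma eval_of_nat [simp]: "eval a (of_nat k) = of_nat k"
  by (induction k) simp_all

lemma eval_Var [simp]: "eval a (Var i) = a i"
  by (simp add: Var_def eval_single eval_mon_def)

lemma eval_scale [simp]: "eval a (scale c p) = c * eval a p"
  by (simp add: scale_def eval_single eval_mon_def)

section \<open>Compositions and increasing index sequences\<close>

lemma composition_Nil [simp]: "composition []"
  and composition_Cons [simp]: "composition (a # \<alpha>) \<longleftrightarrow> 0 < a \<and> composition \<alpha>"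
  by (auto simp: composition_def)

text \<open>The movable lower bound lets the smallest variable be split off; the recursions for
  monomial and fundamental polynomials and for \<open>P\<close> all rest on this split.\<close>

definition index_seqs_from :: "nat \<Rightarrow> nat \<Rightarrow> nat \<Rightarrow> nat list set" where
  "index_seqs_from k n l = {i. length i = l \<and> sorted_wrt (<) i \<and> set i \<subseteq> {k..n}}"

lemma index_seqs_eq_from: "index_seqs n l = index_seqs_from (Suc 0) n l"
  by (simp add: index_seqs_def index_seqs_from_def)

lemma finite_index_seqs_from [simp]: "finite (index_seqs_from k n l)"
  by (rule finite_subset[OF _ finite_lists_length_eq[of "{k..n}" l]]) (auto simp: index_seqs_from_def)

lemma index_seqs_from_0 [simp]: "index_seqs_from k n 0 = {[]}"
  by (auto simp: index_seqs_from_def)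

lemma index_seqs_from_empty: "n < k \<Longrightarrow> index_seqs_from k n (Suc l) = {}"
  by (auto simp: index_seqs_from_def length_Suc_conv)

lemma index_seqs_from_Suc:
  assumes "k \<le> n"
  shows "index_seqs_from k n (Suc l) =
    (#) k ` index_seqs_from (Suc k) n l \<union> index_seqs_from (Suc k) n (Suc l)"
proof (intro Set.set_eqI iffI)
  fix i assume i: "i \<in> index_seqs_from k n (Suc l)"
  then obtain c i' where c: "i = c # i'" by (auto simp: index_seqs_from_def length_Suc_conv)
  show "i \<in> (#) k ` index_seqs_from (Suc k) n l \<union> index_seqs_from (Suc k) n (Suc l)"
  proof (cases "c = k")
    case True
    then have "set i' \<subseteq> {Suc k..n}" using i by (force simp: c index_seqs_from_def Suc_le_eq)
    then show ?thesis using i True by (auto simp: c index_seqs_from_def)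
  next
    case False
    then have "k < c" "\<forall>t \<in> set i'. c < t" using i by (auto simp: c index_seqs_from_def)
    then have "set i \<subseteq> {Suc k..n}" using i by (fastforce simp: c index_seqs_from_def)
    then show ?thesis using i by (simp add: index_seqs_from_def)
  qed
qed (use assms in \<open>auto simp: index_seqs_from_def Suc_le_eq subset_iff intro: less_imp_le\<close>)

lemma sum_index_seqs_from_Suc:
  fixes g :: "nat list \<Rightarrow> 'b::comm_monoid_add"
  assumes "k \<le> n"
  shows "sum g (index_seqs_from k n (Suc l)) =
    (\<Sum>i \<in> index_seqs_from (Suc k) n l. g (k # i)) + sum g (index_seqs_from (Suc k) n (Suc l))"
proof -
  have "(#) k ` index_seqs_from (Suc k) n l \<inter> index_seqs_from (Suc k) n (Suc l) = {}"
    by (auto simp: index_seqs_from_def)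
  then show ?thesis
    by (simp add: index_seqs_from_Suc[OF assms] sum.union_disjoint sum.reindex)
qed

subsection \<open>Monomial and fundamental quasisymmetric polynomials\<close>

definition M_from :: "nat \<Rightarrow> nat \<Rightarrow> nat list \<Rightarrow> mpoly" where
  "M_from k n \<alpha> = (\<Sum>i \<in> index_seqs_from k n (length \<alpha>). \<Prod>j < length \<alpha>. Var (i ! j) ^ (\<alpha> ! j))"

lemma M_eq_M_from: "M n \<alpha> = M_from (Suc 0) n \<alpha>"
  by (simp add: M_def M_from_def index_seqs_eq_from)

lemma M_from_Nil [simp]: "M_from k n [] = 1"
  by (simp add: M_from_def)

lemma M_from_Cons:
  assumes "k \<le> n"
  shows "M_from k n (a # \<alpha>) = Var k ^ a * M_from (Suc k) n \<alpha> + M_from (Suc k) n (a # \<alpha>)"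
  unfolding M_from_def
  by (simp add: sum_index_seqs_from_Suc[OF assms] prod.lessThan_Suc_shift sum_distrib_left
      del: prod.lessThan_Suc)

lemma M_from_eq_0: "n < k \<Longrightarrow> M_from k n (a # \<alpha>) = 0"
  by (simp add: M_from_def index_seqs_from_empty)

lemma M_eq_0:
  assumes "n < length \<alpha>"
  shows "M n \<alpha> = 0"
proof -
  have "length i \<le> n" if "sorted_wrt (<) i" "set i \<subseteq> {1..n}" for i
    using card_mono[OF _ that(2)] that(1) by (simp add: strict_sorted_iff distinct_card)
  then have "index_seqs n (length \<alpha>) = {}"
    using assms by (fastforce simp: index_seqs_def)
  then show ?thesis by (simp add: M_def)
qed

text \<open>Mirrors \<open>M_from_Cons\<close>, which gives up x_k and may or may not remove the
  first part, until no variable is left.\<close>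

lemma M_from_induct [case_names Nil out Cons]:
  assumes "\<And>k. T k []" "\<And>k a \<alpha>. n < k \<Longrightarrow> T k (a # \<alpha>)"
    "\<And>k a \<alpha>. k \<le> n \<Longrightarrow> T (Suc k) \<alpha> \<Longrightarrow> T (Suc k) (a # \<alpha>) \<Longrightarrow> T k (a # \<alpha>)"
  shows "T (k::nat) (\<alpha>::nat list)"
proof (induction "Suc n - k" arbitrary: k \<alpha>)
  case (0 k \<alpha>)
  then show ?case using assms(1,2) by (cases \<alpha>) auto
next
  case (Suc d k \<alpha>)
  then have "k \<le> n" "d = Suc n - Suc k" by auto
  then show ?case using assms(1,3) Suc.hyps(1) by (cases \<alpha>) auto
qed

lemma vars_in_power: "p \<in> vars_in V \<Longrightarrow> p ^ k \<in> vars_in V"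
  by (induction k) (auto intro: vars_in_mult)

lemma Var_power: "Var i ^ a = monomial (Poly_Mapping.single i a)"
  by (induction a) (simp_all add: Var_eq_monomial mult_single flip: single_add)

lemma deg_lt_Var_power: "Var i ^ a \<in> deg_lt (Suc a)"
  by (simp add: Var_power)

lemma M_from_vars_in: "M_from k n \<alpha> \<in> vars_in {k..n}"
proof (induction k \<alpha> rule: M_from_induct[where n = n])
  case (Cons k a \<alpha>)
  have "vars_in {Suc k..n} \<subseteq> vars_in {k..n}" by (rule vars_in_mono) auto
  then show ?case
    using Cons by (auto simp: M_from_Cons intro!: vars_in_add vars_in_mult vars_in_power vars_in_Var)
qed (simp_all add: M_from_eq_0)

lemma M_from_homogeneous: "M_from k n \<alpha> \<in> homogeneous (sum_list \<alpha>)"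
proof (induction k \<alpha> rule: M_from_induct[where n = n])
  case (Cons k a \<alpha>)
  have "Var k ^ a \<in> homogeneous a" by (simp add: Var_power)
  then show ?case
    using homogeneous_mult[OF _ Cons(2)] Cons by (simp add: M_from_Cons homogeneous_add)
qed (simp_all add: M_from_eq_0)

lemma M_from_deg_lt: "M_from k n \<alpha> \<in> deg_lt (Suc (sum_list \<alpha>))"
  using M_from_homogeneous homogeneous_subset_deg_lt by blast

fun increment_hd :: "nat list \<Rightarrow> nat list" where
  "increment_hd (g # \<gamma>) = Suc g # \<gamma>"
| "increment_hd [] = []"

text \<open>Enumerates the terms of the fundamental quasisymmetric polynomial F_beta, the sum of
  M_gamma over the refinements gamma of beta. The first unit of the first part either stands alone
  (\<open>1 #\<close>) or merges with what follows (\<open>increment_hd\<close>), in step with the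
  recursion of F_beta in its smallest variable.\<close>

fun refinements :: "nat list \<Rightarrow> nat list list" where
  "refinements [] = [[]]"
| "refinements (0 # \<beta>) = []"
| "refinements (Suc 0 # \<beta>) = map ((#) 1) (refinements \<beta>)"
| "refinements (Suc (Suc a) # \<beta>) =
     map ((#) 1) (refinements (Suc a # \<beta>)) @ map increment_hd (refinements (Suc a # \<beta>))"

lemma refinements_properties:
  assumes "composition \<beta>" "\<gamma> \<in> set (refinements \<beta>)"
  shows "composition \<gamma> \<and> sum_list \<gamma> = sum_list \<beta> \<and> (\<beta> \<noteq> [] \<longrightarrow> \<gamma> \<noteq> [])"
  using assms
proof (induction \<beta> arbitrary: \<gamma> rule: refinements.induct)
  case (4 a \<beta>)
  then consider \<gamma>' where "\<gamma> = 1 # \<gamma>'" "\<gamma>' \<in> set (refinements (Suc a # \<beta>))"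
    | \<gamma>' where "\<gamma> = increment_hd \<gamma>'" "\<gamma>' \<in> set (refinements (Suc a # \<beta>))"
    by auto
  then show ?case
  proof cases
    case (1 \<gamma>')
    then show ?thesis using "4.IH"[of \<gamma>'] "4.prems" by simp
  next
    case (2 \<gamma>')
    then show ?thesis using "4.IH"[of \<gamma>'] "4.prems" by (cases \<gamma>') simp_all
  qed
qed auto

definition F_from :: "nat \<Rightarrow> nat \<Rightarrow> nat list \<Rightarrow> mpoly" where
  "F_from k n \<beta> = (\<Sum>\<gamma> \<leftarrow> refinements \<beta>. M_from k n \<gamma>)"

lemma F_from_Nil [simp]: "F_from k n [] = 1"
  by (simp add: F_from_def)

lemma F_from_one:
  "k \<le> n \<Longrightarrow> F_from k n (Suc 0 # \<beta>) = Var k * F_from (Suc k) n \<beta> + F_from (Suc k) n (Suc 0 # \<beta>)"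
  by (simp add: F_from_def o_def M_from_Cons sum_list_addf sum_list_const_mult)

text \<open>F_beta sums over index sequences that increase weakly inside a part. If the smallest
  index is k, one factor x_k is removed and k stays available for the rest of the first part, hence
  \<open>F_from k\<close> and not \<open>F_from (Suc k)\<close> in the product.\<close>

lemma F_from_Suc_Suc:
  assumes "k \<le> n" "composition \<beta>"
  shows "F_from k n (Suc (Suc a) # \<beta>) =
    Var k * F_from k n (Suc a # \<beta>) + F_from (Suc k) n (Suc (Suc a) # \<beta>)"
proof -
  let ?R = "refinements (Suc a # \<beta>)"
  have *: "M_from k n (1 # \<gamma>) + M_from k n (increment_hd \<gamma>) = Var k * M_from k n \<gamma> +
      (M_from (Suc k) n (1 # \<gamma>) + M_from (Suc k) n (increment_hd \<gamma>))" if "\<gamma> \<in> set ?R" for \<gamma>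
  proof -
    have "\<gamma> \<noteq> []" using refinements_properties[OF _ that] assms(2) by simp
    then obtain g \<gamma>' where "\<gamma> = g # \<gamma>'" by (cases \<gamma>) auto
    then show ?thesis by (simp add: M_from_Cons[OF assms(1)] algebra_simps)
  qed
  have "F_from k n (Suc (Suc a) # \<beta>) = (\<Sum>\<gamma>\<leftarrow>?R. M_from k n (1 # \<gamma>) + M_from k n (increment_hd \<gamma>))"
    by (simp add: F_from_def o_def sum_list_addf)
  also have "\<dots> = (\<Sum>\<gamma>\<leftarrow>?R. Var k * M_from k n \<gamma> +
      (M_from (Suc k) n (1 # \<gamma>) + M_from (Suc k) n (increment_hd \<gamma>)))"
    using * by (intro arg_cong[where f = sum_list] map_cong) auto
  also have "\<dots> = Var k * F_from k n (Suc a # \<beta>) + F_from (Suc k) n (Suc (Suc a) # \<beta>)"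
    by (simp add: F_from_def o_def sum_list_addf sum_list_const_mult)
  finally show ?thesis .
qed

lemma sum_list_closed:
  fixes h :: "'a \<Rightarrow> 'b::monoid_add"
  assumes "0 \<in> S" "\<And>p q. p \<in> S \<Longrightarrow> q \<in> S \<Longrightarrow> p + q \<in> S" "\<And>x. x \<in> set xs \<Longrightarrow> h x \<in> S"
  shows "(\<Sum>x\<leftarrow>xs. h x) \<in> S"
  using assms(3) by (induction xs) (simp_all add: assms)

lemma F_from_vars_in: "F_from k n \<beta> \<in> vars_in {k..n}"
  unfolding F_from_def
  by (rule sum_list_closed) (simp_all add: vars_in_add M_from_vars_in)

text \<open>
  \<open>G_from k n w \<beta>\<close> is the polynomial in \<open>x\<^sub>k, \<dots>, x\<^sub>n\<close> that Aval, Bergeron and Bergeron attach to the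
  exponent vector \<open>rev w @ \<beta>\<close>, where \<open>\<beta>\<close> is a composition. Its lexicographically leading monomial has
  this exponent vector, and for \<open>k = 1\<close> it lies in the ideal generated by the quasisymmetric
  polynomials as soon as the exponent vector is transdiagonal.
\<close>

function G_from :: "nat \<Rightarrow> nat \<Rightarrow> nat list \<Rightarrow> nat list \<Rightarrow> mpoly" where
  "G_from k n [] \<beta> = F_from k n \<beta>"
| "G_from k n (0 # w) [] = G_from k n w []"
| "G_from k n (0 # w) (b # \<beta>) = G_from k n w (b # \<beta>) - Var (k + length w) *
     (if b \<le> 1 then G_from k n (0 # w) \<beta> else G_from k n w ((b - 1) # \<beta>))"
| "G_from k n (Suc a # w) \<beta> = G_from k n w (Suc a # \<beta>)"
  by pat_completeness auto
termination
  by (relation "measures [\<lambda>(k, n, w, \<beta>). length w + length \<beta>, \<lambda>(k, n, w, \<beta>). length w]") auto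

text \<open>As \<open>w\<close> is reversed, its last entry is the exponent of x_k. For empty
  \<open>w\<close> the subtraction in \<open>G_from\<close> cancels exactly the part of F that
  involves x_k, by \<open>F_from_one\<close> or \<open>F_from_Suc_Suc\<close>. Lowering an entry 1
  creates a new zero, which is why \<open>G_from\<close> keeps \<open>0 # w\<close> in that
  case.\<close>

lemma G_from_0_last:
  "k \<le> n \<Longrightarrow> composition \<beta> \<Longrightarrow> G_from k n (w @ [0]) \<beta> = G_from (Suc k) n w \<beta>"
proof (induction "Suc k" n w \<beta> rule: G_from.induct)
  case (1 n \<beta>)
  then show ?case
  proof (induction \<beta>)
    case (Cons b \<beta>)
    show ?case
    proof (cases "b \<le> 1")
      case True
      then have "b = Suc 0" using Cons.prems by simp
      then show ?thesis using Cons by (simp add: F_from_one)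
    next
      case False
      then obtain b' where "b = Suc (Suc b')" by (auto simp: not_le dest!: less_imp_Suc_add)
      then show ?thesis using Cons by (simp add: F_from_Suc_Suc)
    qed
  qed simp
qed auto

text \<open>The recursions of F in its smallest variable give this for empty \<open>w\<close>, and
  the zero rule preserves it since its variable is not x_k. The length bound says that the whole
  exponent vector fits into x_k, ..., x_n, which keeps that variable in range.\<close>

lemma G_from_Suc_last:
  assumes "k + length w + length \<beta> \<le> n" "composition \<beta>"
  shows "\<exists>p \<in> vars_in {Suc k..n}. G_from k n (w @ [Suc a]) \<beta> = Var k * G_from k n (w @ [a]) \<beta> + p"
  using assms
proof (induction k n w \<beta> rule: G_from.induct)
  case (1 k n \<beta>)
  show ?case
  proof (cases a)
    case 0
    then show ?thesis using 1 G_from_0_last[of k n \<beta> "[]"]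
      by (auto simp: F_from_one intro!: bexI[of _ "F_from (Suc k) n (Suc 0 # \<beta>)"] F_from_vars_in)
  next
    case (Suc a')
    then show ?thesis using 1
      by (auto simp: F_from_Suc_Suc intro!: bexI[of _ "F_from (Suc k) n (Suc (Suc a') # \<beta>)"] F_from_vars_in)
  qed
next
  case (3 k n w b \<beta>)
  let ?G = "\<lambda>a. if b \<le> 1 then G_from k n ((0 # w) @ [a]) \<beta> else G_from k n (w @ [a]) ((b - 1) # \<beta>)"
  have "\<exists>p \<in> vars_in {Suc k..n}. G_from k n (w @ [Suc a]) (b # \<beta>) =
      Var k * G_from k n (w @ [a]) (b # \<beta>) + p"
    using 3 by simp
  then obtain p where p: "p \<in> vars_in {Suc k..n}"
    "G_from k n (w @ [Suc a]) (b # \<beta>) = Var k * G_from k n (w @ [a]) (b # \<beta>) + p" by blast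
  have "\<exists>q \<in> vars_in {Suc k..n}. ?G (Suc a) = Var k * ?G a + q"
    using 3 by (cases "b \<le> 1") simp_all
  then obtain q where q: "q \<in> vars_in {Suc k..n}" "?G (Suc a) = Var k * ?G a + q" by blast
  have "Var (Suc (k + length w)) \<in> vars_in {Suc k..n}"
    using 3 by (intro vars_in_Var) auto
  then have "p - Var (Suc (k + length w)) * q \<in> vars_in {Suc k..n}"
    using p q by (intro vars_in_diff vars_in_mult)
  moreover have G: "G_from k n ((0 # w) @ [a]) (b # \<beta>) =
      G_from k n (w @ [a]) (b # \<beta>) - Var (Suc (k + length w)) * ?G a" for a
    by simp
  have "G_from k n ((0 # w) @ [Suc a]) (b # \<beta>) =
      Var k * G_from k n ((0 # w) @ [a]) (b # \<beta>) + (p - Var (Suc (k + length w)) * q)"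
    unfolding G[of a] G[of "Suc a"] p(2) q(2) by (simp only: algebra_simps)
  ultimately show ?case by blast
qed auto

subsection \<open>Leading monomials\<close>

fun mon_from :: "nat \<Rightarrow> nat list \<Rightarrow> nat \<Rightarrow>\<^sub>0 nat" where
  "mon_from k [] = 0"
| "mon_from k (a # \<epsilon>) = Poly_Mapping.single k a + mon_from (Suc k) \<epsilon>"

lemma lookup_mon_from:
  "Poly_Mapping.lookup (mon_from k \<epsilon>) i = (if k \<le> i \<and> i < k + length \<epsilon> then \<epsilon> ! (i - k) else 0)"
  by (induction k \<epsilon> rule: mon_from.induct)
    (auto simp: lookup_add lookup_single when_def nth_Cons')

lemma keys_mon_from: "Poly_Mapping.keys (mon_from k \<epsilon>) \<subseteq> {k..<k + length \<epsilon>}"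
  by (auto simp: in_keys_iff lookup_mon_from split: if_splits)

lemma lookup_monomial_mult: "Poly_Mapping.lookup (monomial s * p) (s + m) = Poly_Mapping.lookup p m"
proof -
  have "monomial s * p = (\<Sum>x \<in> Poly_Mapping.keys p. Poly_Mapping.single (s + x) (Poly_Mapping.lookup p x))"
    by (subst mpoly_sum_singles[of p]) (simp add: sum_distrib_left mult_single)
  then show ?thesis
    by (simp add: lookup_sum lookup_single when_def in_keys_iff)
qed

lemma less_poly_mappingI:
  fixes m m' :: "nat \<Rightarrow>\<^sub>0 nat"
  assumes "Poly_Mapping.lookup m k < Poly_Mapping.lookup m' k"
    "\<And>j. j < k \<Longrightarrow> Poly_Mapping.lookup m j = Poly_Mapping.lookup m' j"
  shows "m < m'"
  using assms by (auto simp: less_poly_mapping.rep_eq less_fun_def)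

definition has_leading_mon :: "mpoly \<Rightarrow> (nat \<Rightarrow>\<^sub>0 nat) \<Rightarrow> bool" where
  "has_leading_mon p m \<longleftrightarrow> Poly_Mapping.lookup p m = 1 \<and> (\<forall>m' \<in> Poly_Mapping.keys p. m' \<le> m)"

text \<open>Since the order on monomials is lexicographic, a polynomial in \<open>x\<^sub>k\<^sub>+\<^sub>1, \<dots>, x\<^sub>n\<close> is negligible
  against any multiple of \<open>x\<^sub>k\<close>.\<close>

lemma has_leading_mon_Var_mult_add:
  assumes p: "has_leading_mon p m" and m: "Poly_Mapping.keys m \<subseteq> {k..}" and q: "q \<in> vars_in {Suc k..n}"
  shows "has_leading_mon (Var k * p + q) (Poly_Mapping.single k 1 + m)"
proof -
  let ?m = "Poly_Mapping.single k 1 + m"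
  have less: "m' < ?m" if "m' \<in> Poly_Mapping.keys q" for m'
  proof (rule less_poly_mappingI[of _ k])
    have m': "Poly_Mapping.keys m' \<subseteq> {Suc k..n}" using q that by (auto simp: vars_in_def)
    then have zero: "Poly_Mapping.lookup m' j = 0" if "j \<le> k" for j
      using that by (metis atLeastAtMost_iff in_keys_iff not_less_eq_eq subsetD)
    show "Poly_Mapping.lookup m' k < Poly_Mapping.lookup ?m k"
      by (simp add: zero lookup_add)
    fix j assume "j < k"
    then have "Poly_Mapping.lookup m j = 0" using m by (metis atLeast_iff in_keys_iff not_le subsetD)
    then show "Poly_Mapping.lookup m' j = Poly_Mapping.lookup ?m j"
      using \<open>j < k\<close> by (simp add: zero lookup_add lookup_single)
  qed
  then have "Poly_Mapping.lookup q ?m = 0"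
    by (metis in_keys_iff less_irrefl)
  then have "Poly_Mapping.lookup (Var k * p + q) ?m = 1"
    using p lookup_monomial_mult[of "Poly_Mapping.single k 1" p m]
    by (simp add: has_leading_mon_def lookup_add Var_eq_monomial)
  moreover have "m' \<le> ?m" if m': "m' \<in> Poly_Mapping.keys (Var k * p + q)" for m'
  proof (cases "m' \<in> Poly_Mapping.keys q")
    case True
    then show ?thesis using less by (simp add: less_imp_le)
  next
    case False
    then have "m' \<in> Poly_Mapping.keys (Var k * p)"
      using m' Poly_Mapping.keys_add[of "Var k * p" q] by blast
    then obtain x where "m' = Poly_Mapping.single k 1 + x" "x \<in> Poly_Mapping.keys p"
      using keys_mult[of "Var k" p] by (auto simp: Var_def)
    then show ?thesis using p by (simp add: has_leading_mon_def add_left_mono)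
  qed
  ultimately show ?thesis by (simp add: has_leading_mon_def)
qed

text \<open>Nested induction: \<open>G_from_0_last\<close> settles exponent 0 of x_k by passing to
  x_{k+1}, and \<open>G_from_Suc_last\<close> raises the exponent one step at a time.\<close>

lemma has_leading_mon_G_from:
  "k + length \<epsilon> \<le> Suc n \<Longrightarrow> has_leading_mon (G_from k n (rev \<epsilon>) []) (mon_from k \<epsilon>)"
proof (induction \<epsilon> arbitrary: k)
  case Nil
  then show ?case by (simp add: has_leading_mon_def)
next
  case (Cons a \<epsilon>)
  show ?case
    using Cons.prems
  proof (induction a)
    case 0
    then show ?case using Cons.IH[of "Suc k"] by (simp add: G_from_0_last)
  next
    case (Suc a)
    then obtain p where p: "p \<in> vars_in {Suc k..n}"
      "G_from k n (rev \<epsilon> @ [Suc a]) [] = Var k * G_from k n (rev \<epsilon> @ [a]) [] + p"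
      using G_from_Suc_last[of k "rev \<epsilon>" "[]" n a] by auto
    have "has_leading_mon (Var k * G_from k n (rev \<epsilon> @ [a]) [] + p)
        (Poly_Mapping.single k 1 + mon_from k (a # \<epsilon>))"
      using Suc keys_mon_from[of k "a # \<epsilon>"] by (intro has_leading_mon_Var_mult_add[OF _ _ p(1)]) auto
    then show ?case using p
      by (simp add: add.assoc[symmetric] flip: single_add)
  qed
qed

subsection \<open>Filtered ideals\<close>

text \<open>Collects what has a representation whose terms all have formal degree below
  \<open>d\<close>. For inhomogeneous \<open>A\<close> this is a priori stronger than membership in
  the ideal plus a degree bound, since leading terms might cancel; it is the form in which degree
  bounds pass from the M_alpha to the P_alpha.\<close>

definition filtered_ideal :: "nat \<Rightarrow> (nat list \<Rightarrow> mpoly) \<Rightarrow> nat \<Rightarrow> mpoly set" where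
  "filtered_ideal n A d = mpoly.span {monomial m * A \<alpha> | m \<alpha>. Poly_Mapping.keys m \<subseteq> {1..n} \<and>
     composition \<alpha> \<and> \<alpha> \<noteq> [] \<and> length \<alpha> \<le> n \<and> mon_degree m + sum_list \<alpha> < d}"

lemma subspace_filtered_ideal: "mpoly.subspace (filtered_ideal n A d)"
  by (simp add: filtered_ideal_def)

lemmas filtered_ideal_add = mpoly.subspace_add[OF subspace_filtered_ideal]
  and filtered_ideal_diff = mpoly.subspace_diff[OF subspace_filtered_ideal]
  and filtered_ideal_scale = mpoly.subspace_scale[OF subspace_filtered_ideal]
  and filtered_ideal_0 = mpoly.subspace_0[OF subspace_filtered_ideal]

lemma filtered_ideal_base:
  assumes "Poly_Mapping.keys m \<subseteq> {1..n}" "composition \<alpha>" "\<alpha> \<noteq> []" "length \<alpha> \<le> n"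
    "mon_degree m + sum_list \<alpha> < d"
  shows "monomial m * A \<alpha> \<in> filtered_ideal n A d"
  unfolding filtered_ideal_def by (rule mpoly.span_base) (use assms in blast)

lemma filtered_ideal_induct:
  assumes "p \<in> filtered_ideal n A d" "mpoly.subspace S"
    "\<And>m \<alpha>. Poly_Mapping.keys m \<subseteq> {1..n} \<Longrightarrow> composition \<alpha> \<Longrightarrow> \<alpha> \<noteq> [] \<Longrightarrow> length \<alpha> \<le> n \<Longrightarrow>
       mon_degree m + sum_list \<alpha> < d \<Longrightarrow> monomial m * A \<alpha> \<in> S"
  shows "p \<in> S"
  using assms(1) unfolding filtered_ideal_def
  by (rule subsetD[OF mpoly.span_minimal[OF _ assms(2)], rotated]) (use assms(3) in auto)

lemma filtered_ideal_mono: "d \<le> e \<Longrightarrow> filtered_ideal n A d \<subseteq> filtered_ideal n A e"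
  unfolding filtered_ideal_def by (rule mpoly.span_mono) (use order.strict_trans2 in blast)

lemma filtered_ideal_monomial_mult:
  assumes m: "Poly_Mapping.keys m \<subseteq> {1..n}" and p: "p \<in> filtered_ideal n A d"
  shows "monomial m * p \<in> filtered_ideal n A (mon_degree m + d)"
proof -
  have "p \<in> {p. monomial m * p \<in> filtered_ideal n A (mon_degree m + d)}"
    using p
  proof (rule filtered_ideal_induct)
    show "mpoly.subspace {p. monomial m * p \<in> filtered_ideal n A (mon_degree m + d)}"
      by (rule mpoly.subspaceI)
        (auto simp: distrib_left scale_mult_right filtered_ideal_0 filtered_ideal_add filtered_ideal_scale)
    fix m' \<alpha> assume "Poly_Mapping.keys m' \<subseteq> {1..n}" "composition \<alpha>" "\<alpha> \<noteq> []" "length \<alpha> \<le> n"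
      "mon_degree m' + sum_list \<alpha> < d"
    moreover from this(1) have "Poly_Mapping.keys (m + m') \<subseteq> {1..n}"
      using m Poly_Mapping.keys_add[of m m'] by blast
    ultimately have "monomial (m + m') * A \<alpha> \<in> filtered_ideal n A (mon_degree m + d)"
      by (intro filtered_ideal_base) auto
    then show "monomial m' * A \<alpha> \<in> {p. monomial m * p \<in> filtered_ideal n A (mon_degree m + d)}"
      by (simp add: monomial_add mult.assoc)
  qed
  then show ?thesis by simp
qed

lemma filtered_ideal_carrier:
  assumes "\<And>\<alpha>. A \<alpha> \<in> poly_carrier n"
  shows "filtered_ideal n A d \<subseteq> poly_carrier n"
proof
  fix p assume "p \<in> filtered_ideal n A d"
  then show "p \<in> poly_carrier n"
  proof (rule filtered_ideal_induct[OF _ subspace_poly_carrier])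
    fix m :: "nat \<Rightarrow>\<^sub>0 nat" and \<alpha> assume "Poly_Mapping.keys m \<subseteq> {1..n}"
    then have "monomial m \<in> poly_carrier n" by (simp add: poly_carrier_def)
    then show "monomial m * A \<alpha> \<in> poly_carrier n" using assms by (rule poly_carrier_mult)
  qed
qed

lemma filtered_ideal_deg_lt:
  assumes "\<And>\<alpha>. composition \<alpha> \<Longrightarrow> A \<alpha> \<in> deg_lt (Suc (sum_list \<alpha>))"
  shows "filtered_ideal n A d \<subseteq> deg_lt d"
proof
  fix p assume "p \<in> filtered_ideal n A d"
  then show "p \<in> deg_lt d"
  proof (rule filtered_ideal_induct[OF _ subspace_deg_lt])
    fix m \<alpha> assume "composition \<alpha>" "mon_degree m + sum_list \<alpha> < d"
    then have "monomial m * A \<alpha> \<in> deg_lt (mon_degree m + Suc (sum_list \<alpha>))"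
      by (intro deg_lt_mult assms) simp_all
    then show "monomial m * A \<alpha> \<in> deg_lt d"
      using deg_lt_mono[of "mon_degree m + Suc (sum_list \<alpha>)" d] \<open>_ < d\<close> by auto
  qed
qed

lemma M_carrier: "M n \<alpha> \<in> poly_carrier n"
  using M_in_R[of n \<alpha>] by (simp add: R_def)

lemma M_deg_lt: "M n \<alpha> \<in> deg_lt (Suc (sum_list \<alpha>))"
  by (simp add: M_eq_M_from M_from_deg_lt)

subsection \<open>Transdiagonal exponent vectors\<close>

definition transdiagonal :: "nat list \<Rightarrow> bool" where
  "transdiagonal \<epsilon> \<longleftrightarrow> (\<exists>i. 1 \<le> i \<and> i \<le> length \<epsilon> \<and> i \<le> sum_list (take i \<epsilon>))"

lemma transdiagonal_snoc_0:
  assumes "transdiagonal (u @ [0])"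
  shows "transdiagonal u"
proof -
  obtain i where i: "1 \<le> i" "i \<le> Suc (length u)" "i \<le> sum_list (take i (u @ [0]))"
    using assms by (auto simp: transdiagonal_def)
  show ?thesis
  proof (cases "i \<le> length u")
    case True
    then show ?thesis using i by (auto simp: transdiagonal_def)
  next
    case False
    then have "i = Suc (length u)" using i by simp
    then have "Suc (length u) \<le> sum_list u" using i by simp
    then have "u \<noteq> []" "length u \<le> sum_list (take (length u) u)" by auto
    then show ?thesis unfolding transdiagonal_def by (intro exI[of _ "length u"]) (auto simp: Suc_le_eq)
  qed
qed

text \<open>Deleting the 0 shortens every later prefix by one, and lowering \<open>b\<close> costs
  at most one in its sum, so the witness \<open>i\<close> moves to \<open>i - 1\<close>. If the
  witness ends at the 0 itself, \<open>u\<close> alone suffices.\<close>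

lemma transdiagonal_shift:
  assumes "transdiagonal (u @ 0 # b # \<beta>)" "0 < b"
  shows "transdiagonal (u @ b # \<beta>)" "transdiagonal (u @ (b - 1) # \<beta>)"
proof -
  obtain i where i: "1 \<le> i" "i \<le> length (u @ 0 # b # \<beta>)" "i \<le> sum_list (take i (u @ 0 # b # \<beta>))"
    using assms by (auto simp: transdiagonal_def)
  have "transdiagonal (u @ b # \<beta>) \<and> transdiagonal (u @ (b - 1) # \<beta>)"
  proof (cases "i \<le> length u")
    case True
    then show ?thesis using i by (auto simp: transdiagonal_def)
  next
    case False
    then obtain r where r: "i = Suc (length u + r)" by (metis less_imp_Suc_add not_le)
    show ?thesis
    proof (cases r)
      case 0
      then have "length u < sum_list u" using i r by simp
      then have "u \<noteq> []" "length u \<le> sum_list (take (length u) (u @ v))" for v by auto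
      then show ?thesis unfolding transdiagonal_def
        by (intro conjI exI[of _ "length u"]) (auto simp: Suc_le_eq)
    next
      case (Suc r')
      then have "i - 1 = length u + Suc r'" "r' \<le> length \<beta>"
        "Suc (length u + r) \<le> sum_list u + b + sum_list (take r' \<beta>)"
        using i r by auto
      then show ?thesis unfolding transdiagonal_def
        using assms(2) Suc by (intro conjI exI[of _ "i - 1"]) auto
    qed
  qed
  then show "transdiagonal (u @ b # \<beta>)" "transdiagonal (u @ (b - 1) # \<beta>)" by auto
qed

lemma F_from_in_filtered_ideal:
  assumes "composition \<beta>" "\<beta> \<noteq> []"
  shows "F_from (Suc 0) n \<beta> \<in> filtered_ideal n (M n) (Suc (sum_list \<beta>))"
  unfolding F_from_def M_eq_M_from[symmetric]
proof (rule sum_list_closed)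
  fix \<gamma> assume "\<gamma> \<in> set (refinements \<beta>)"
  then have \<gamma>: "composition \<gamma>" "sum_list \<gamma> = sum_list \<beta>" "\<gamma> \<noteq> []"
    using refinements_properties assms by blast+
  show "M n \<gamma> \<in> filtered_ideal n (M n) (Suc (sum_list \<beta>))"
  proof (cases "length \<gamma> \<le> n")
    case True
    then show ?thesis using filtered_ideal_base[of 0 n \<gamma> "Suc (sum_list \<beta>)" "M n"] \<gamma> by simp
  next
    \<comment> \<open>Refinements with more than n parts are not among the generators, but their
      \<open>M\<close> is zero.\<close>
    case False
    then show ?thesis by (simp add: M_eq_0 filtered_ideal_0)
  qed
qed (simp_all add: filtered_ideal_0 filtered_ideal_add)

text \<open>Every rule of \<open>G_from\<close> passes transdiagonality on, and the extra variable
  makes up for a lowered entry in the degree. The recursion ends in \<open>F_from\<close> of a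
  nonempty composition, because the empty vector is not transdiagonal.\<close>

lemma G_from_in_filtered_ideal:
  assumes "transdiagonal (rev w @ \<beta>)" "composition \<beta>" "length w + length \<beta> \<le> n"
  shows "G_from (Suc 0) n w \<beta> \<in> filtered_ideal n (M n) (Suc (sum_list w + sum_list \<beta>))"
  using assms
proof (induction "Suc 0" n w \<beta> rule: G_from.induct)
  case (1 n \<beta>)
  then have "\<beta> \<noteq> []" by (auto simp: transdiagonal_def)
  then show ?case using 1 by (simp add: F_from_in_filtered_ideal)
next
  case (2 n w)
  then show ?case by (simp add: transdiagonal_snoc_0)
next
  case (3 n w b \<beta>)
  let ?d = "sum_list w + (b + sum_list \<beta>)"
  let ?G = "if b \<le> 1 then G_from (Suc 0) n (0 # w) \<beta> else G_from (Suc 0) n w ((b - 1) # \<beta>)"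
  have b: "0 < b" using 3 by simp
  have td: "transdiagonal (rev w @ b # \<beta>)" "transdiagonal (rev w @ (b - 1) # \<beta>)"
    using 3 b transdiagonal_shift[of "rev w" b \<beta>] by simp_all
  have "?G \<in> filtered_ideal n (M n) ?d"
  proof (cases "b \<le> 1")
    case True
    then have "b = 1" using b by simp
    then show ?thesis using 3 td by simp
  next
    case False
    then have "G_from (Suc 0) n w ((b - 1) # \<beta>)
        \<in> filtered_ideal n (M n) (Suc (sum_list w + sum_list ((b - 1) # \<beta>)))"
      using 3 td by simp
    then show ?thesis using False by simp
  qed
  then have "monomial (Poly_Mapping.single (Suc (length w)) 1) * ?G \<in> filtered_ideal n (M n)
      (mon_degree (Poly_Mapping.single (Suc (length w)) (1::nat)) + ?d)"
    using 3 by (intro filtered_ideal_monomial_mult) auto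
  moreover have "G_from (Suc 0) n w (b # \<beta>) \<in> filtered_ideal n (M n) (Suc ?d)"
    using 3 td by simp
  ultimately show ?case
    by (simp add: Var_eq_monomial filtered_ideal_diff)
next
  case (4 n a w \<beta>)
  then show ?case by (simp add: algebra_simps)
qed

section \<open>Reduction to subdiagonal monomials modulo the M_alpha\<close>

definition subdiagonal :: "nat \<Rightarrow> (nat \<Rightarrow>\<^sub>0 nat) set" where
  "subdiagonal n = {m. Poly_Mapping.keys m \<subseteq> {1..n} \<and>
     \<not> transdiagonal (map (Poly_Mapping.lookup m) [1..<Suc n])}"

definition subdiagonal_lt :: "nat \<Rightarrow> nat \<Rightarrow> (nat \<Rightarrow>\<^sub>0 nat) set" where
  "subdiagonal_lt n d = {m \<in> subdiagonal n. mon_degree m < d}"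

lemma mon_from_lookup:
  assumes "Poly_Mapping.keys m \<subseteq> {1..n}"
  shows "mon_from (Suc 0) (map (Poly_Mapping.lookup m) [1..<Suc n]) = m"
proof (rule poly_mapping_eqI)
  fix i
  have "Poly_Mapping.lookup m i = 0" if "i \<notin> {1..n}"
    using that assms by (metis in_keys_iff subsetD)
  then show "Poly_Mapping.lookup (mon_from (Suc 0) (map (Poly_Mapping.lookup m) [1..<Suc n])) i =
      Poly_Mapping.lookup m i"
    by (auto simp: lookup_mon_from simp del: upt_Suc)
qed

lemma sum_list_map_lookup:
  assumes "Poly_Mapping.keys m \<subseteq> {1..n}"
  shows "sum_list (map (Poly_Mapping.lookup m) [1..<Suc n]) = mon_degree m"
  using assms by (subst mon_degree_eq_sum[of "{1..n}"])
    (auto simp: interv_sum_list_conv_sum_set_nat atLeastLessThanSuc_atLeastAtMost simp del: upt_Suc)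

text \<open>Division by the polynomials \<open>G_from\<close>: a monomial that is not subdiagonal is
  the leading monomial of one that lies in the ideal, and so can be traded for lexicographically
  smaller monomials without leaving the degree bound.\<close>

lemma in_span_subdiagonal_plus:
  assumes "p \<in> poly_carrier n" "p \<in> deg_lt d"
  shows "\<exists>b \<in> mpoly.span (monomial ` subdiagonal_lt n d). p - b \<in> filtered_ideal n (M n) d"
proof -
  let ?S = "{m. Poly_Mapping.keys m \<subseteq> {1..n} \<and> mon_degree m < d}"
  let ?X = "{p. \<exists>b \<in> mpoly.span (monomial ` subdiagonal_lt n d). p - b \<in> filtered_ideal n (M n) d}"
  have X: "mpoly.subspace ?X"
  proof (rule mpoly.subspaceI)
    show "0 \<in> ?X" by (auto intro!: bexI[of _ 0] simp: mpoly.span_zero filtered_ideal_0)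
  next
    fix p q assume "p \<in> ?X" "q \<in> ?X"
    then obtain b b' where "b \<in> mpoly.span (monomial ` subdiagonal_lt n d)"
      "b' \<in> mpoly.span (monomial ` subdiagonal_lt n d)"
      "p - b \<in> filtered_ideal n (M n) d" "q - b' \<in> filtered_ideal n (M n) d" by auto
    then show "p + q \<in> ?X"
      using filtered_ideal_add[of "p - b" n "M n" d "q - b'"]
      by (auto intro!: bexI[of _ "b + b'"] simp: mpoly.span_add algebra_simps)
  next
    fix c p assume "p \<in> ?X"
    then obtain b where "b \<in> mpoly.span (monomial ` subdiagonal_lt n d)" "p - b \<in> filtered_ideal n (M n) d"
      by auto
    then show "scale c p \<in> ?X"
      using filtered_ideal_scale[of "p - b" n "M n" d c]
      by (auto intro!: bexI[of _ "scale c b"] simp: mpoly.span_scale mpoly.scale_right_diff_distrib)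
  qed
  have monomial: "monomial m \<in> ?X" if "m \<in> ?S" for m
    using that
  \<comment> \<open>On all monomials the lexicographic order is not well-founded (x_1 > x_2 > ...),
    so the induction counts the smaller elements of the finite set \<open>?S\<close>.\<close>
  proof (induction "card {m' \<in> ?S. m' < m}" arbitrary: m rule: less_induct)
    case less
    have IH: "monomial m' \<in> ?X" if "m' \<in> ?S" "m' < m" for m'
    proof (rule less.hyps)
      show "card {x \<in> ?S. x < m'} < card {x \<in> ?S. x < m}"
        using that by (intro psubset_card_mono finite_subset[OF _ finite_monomials_of_degree[of n d]]) auto
    qed (use that in simp)
    show ?case
    proof (cases "m \<in> subdiagonal n")
      case True
      then have "monomial m \<in> mpoly.span (monomial ` subdiagonal_lt n d)"
        using less.prems by (intro mpoly.span_base) (auto simp: subdiagonal_lt_def)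
      then show ?thesis by (auto intro!: bexI[of _ "monomial m"] simp: filtered_ideal_0)
    next
      case False
      define \<epsilon> where "\<epsilon> = map (Poly_Mapping.lookup m) [1..<Suc n]"
      define g where "g = G_from (Suc 0) n (rev \<epsilon>) []"
      have \<epsilon>: "length \<epsilon> = n" "mon_from (Suc 0) \<epsilon> = m" "sum_list \<epsilon> = mon_degree m" "transdiagonal \<epsilon>"
        using less.prems False mon_from_lookup sum_list_map_lookup
        by (auto simp: \<epsilon>_def subdiagonal_def simp del: upt_Suc)
      have g: "g \<in> filtered_ideal n (M n) (Suc (mon_degree m))"
        using G_from_in_filtered_ideal[of "rev \<epsilon>" "[]" n] \<epsilon> by (simp add: g_def sum_list_rev)
      then have g_d: "g \<in> filtered_ideal n (M n) d"
        using less.prems filtered_ideal_mono[of "Suc (mon_degree m)" d] by auto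
      then have "g \<in> ?X" by (auto intro!: bexI[of _ 0] simp: mpoly.span_zero)
      have lead: "has_leading_mon g m"
        using has_leading_mon_G_from[of "Suc 0" \<epsilon> n] \<epsilon> by (simp add: g_def)
      have "monomial m' \<in> ?X" if "m' \<in> Poly_Mapping.keys (g - monomial m)" for m'
      proof (rule IH)
        have *: "m' \<noteq> m" "m' \<in> Poly_Mapping.keys g"
          using that lead by (auto simp: has_leading_mon_def in_keys_iff lookup_minus lookup_single when_def
              split: if_splits)
        then show "m' < m" using lead by (auto simp: has_leading_mon_def)
        \<comment> \<open>Membership in the filtered ideal bounds both degree and variables of
          \<open>g\<close>, so its other monomials stay in \<open>?S\<close>.\<close>
        have "g \<in> deg_lt d" "g \<in> poly_carrier n"
          using g_d filtered_ideal_deg_lt[of "M n" n d] filtered_ideal_carrier[of "M n" n d]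
          by (auto simp: M_deg_lt M_carrier)
        then show "m' \<in> ?S" using * by (auto simp: deg_lt_def poly_carrier_def)
      qed
      then have "mpoly.span (monomial ` Poly_Mapping.keys (g - monomial m)) \<subseteq> ?X"
        using X by (intro mpoly.span_minimal) auto
      then have "g - monomial m \<in> ?X" using mpoly_in_span_monomials by blast
      then have "g - (g - monomial m) \<in> ?X" using mpoly.subspace_diff[OF X] \<open>g \<in> ?X\<close> by blast
      then show ?thesis by simp
    qed
  qed
  have "mpoly.span (monomial ` Poly_Mapping.keys p) \<subseteq> ?X"
    using assms monomial X by (intro mpoly.span_minimal) (auto simp: poly_carrier_def deg_lt_def)
  then show ?thesis using mpoly_in_span_monomials by blast
qed

subsection \<open>The inhomogeneous polynomials\<close>

text \<open>The coefficient of X_k N_k^{-1} at the nonempty word formed by the positions p, ..., q -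
  1 of \<alpha>.\<close>

definition block :: "(nat \<Rightarrow> 'a::comm_ring_1) \<Rightarrow> (nat \<Rightarrow> 'a) \<Rightarrow> nat \<Rightarrow> nat list \<Rightarrow> nat \<Rightarrow> nat \<Rightarrow> 'a" where
  "block x c k \<alpha> p q =
     (x k ^ (\<alpha> ! p) - c k ^ (\<alpha> ! p)) * (\<Prod>s \<in> {p + 1..<q}. - (c k ^ (\<alpha> ! s)))"

text \<open>Over an arbitrary ring, so that one recursion serves the polynomials
  (\<open>x = Var\<close>) as well as their values at a point.\<close>

definition P_from ::
  "(nat \<Rightarrow> 'a::comm_ring_1) \<Rightarrow> (nat \<Rightarrow> 'a) \<Rightarrow> nat \<Rightarrow> nat \<Rightarrow> nat list \<Rightarrow> 'a" where
  "P_from x c k n \<alpha> = (\<Sum>\<beta> \<in> {\<beta>. \<beta> \<succeq> \<alpha>}. \<Sum>i \<in> index_seqs_from k n (length \<beta>).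
     \<Prod>j < length \<beta>. block x c (i ! j) \<alpha> (the_breakpoints \<beta> \<alpha> ! j) (the_breakpoints \<beta> \<alpha> ! (j + 1)))"

lemma P_eq_P_from: "P n \<alpha> = P_from Var of_nat (Suc 0) n \<alpha>"
  by (simp add: P_def P_from_def block_def index_seqs_eq_from Let_def)

lemma eval_P: "eval a (P n \<alpha>) = P_from a of_nat (Suc 0) n \<alpha>"
  by (simp add: P_eq_P_from P_from_def block_def)

lemma breakpoints_Nil: "breakpoints [] \<alpha> f \<longleftrightarrow> f = [0] \<and> \<alpha> = []"
  by (auto simp: breakpoints_def length_Suc_conv)

lemma coarsens_Nil_right: "\<beta> \<succeq> [] \<longleftrightarrow> \<beta> = []"
proof
  assume "\<beta> \<succeq> []"
  then obtain f where f: "breakpoints \<beta> [] f" by (auto simp: coarsens_def)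
  show "\<beta> = []"
  proof (rule ccontr)
    assume "\<beta> \<noteq> []"
    then have "f ! 0 < f ! length \<beta>"
      using f by (intro sorted_wrt_nth_less[of "(<)" f]) (auto simp: breakpoints_def)
    then show False using f by (simp add: breakpoints_def)
  qed
qed (auto simp: coarsens_def breakpoints_Nil)

lemma coarsens_Nil_left: "[] \<succeq> \<alpha> \<longleftrightarrow> \<alpha> = []"
  by (auto simp: coarsens_def breakpoints_Nil)

lemma sum_nth_eq_sum_list_take: "r \<le> length \<alpha> \<Longrightarrow> (\<Sum>s \<in> {0..<r}. \<alpha> ! s) = sum_list (take r \<alpha>)"
  for \<alpha> :: "nat list"
  by (simp add: sum_list_sum_nth min_absorb2)

lemma breakpoints_Cons:
  assumes r: "0 < r" "r \<le> length \<alpha>" and f: "breakpoints \<beta> (drop r \<alpha>) f"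
  shows "breakpoints (sum_list (take r \<alpha>) # \<beta>) \<alpha> (0 # map ((+) r) f)"
proof -
  have len: "length f = length \<beta> + 1" using f by (simp add: breakpoints_def)
  have "(sum_list (take r \<alpha>) # \<beta>) ! j =
      (\<Sum>s \<in> {(0 # map ((+) r) f) ! j ..< (0 # map ((+) r) f) ! (j + 1)}. \<alpha> ! s)"
    if "j < length (sum_list (take r \<alpha>) # \<beta>)" for j
  proof (cases j)
    case 0
    have "f ! 0 = 0" "f \<noteq> []" using f len by (auto simp: breakpoints_def)
    then show ?thesis using 0 r len by (simp add: sum_nth_eq_sum_list_take)
  next
    case (Suc j')
    have "\<beta> ! j' = (\<Sum>s \<in> {f ! j' ..< f ! (j' + 1)}. drop r \<alpha> ! s)"
      using f that Suc by (simp add: breakpoints_def)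
    also have "\<dots> = (\<Sum>s \<in> {f ! j' + r ..< f ! (j' + 1) + r}. \<alpha> ! s)"
      using r by (subst sum.shift_bounds_nat_ivl) (simp add: add.commute)
    finally show ?thesis using Suc that len by (simp add: add.commute)
  qed
  then show ?thesis
    using f r len unfolding breakpoints_def
    by (auto simp: sorted_wrt_map nth_Cons' intro: sorted_wrt_mono_rel)
qed

lemma breakpoints_ConsD:
  assumes "breakpoints (b # \<beta>) \<alpha> f"
  obtains r where "0 < r" "r \<le> length \<alpha>" "b = sum_list (take r \<alpha>)"
    "\<exists>g. breakpoints \<beta> (drop r \<alpha>) g"
proof -
  have f: "length f = length \<beta> + 2" "sorted_wrt (<) f" "f ! 0 = 0" "f ! (Suc (length \<beta>)) = length \<alpha>"
    and sums: "\<And>j. j < Suc (length \<beta>) \<Longrightarrow> (b # \<beta>) ! j = (\<Sum>s \<in> {f ! j ..< f ! (j + 1)}. \<alpha> ! s)"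
    using assms by (simp_all add: breakpoints_def)
  define r where "r = f ! 1"
  define g where "g = map (\<lambda>x. x - r) (tl f)"
  have "0 < r" using sorted_wrt_nth_less[OF f(2), of 0 1] f by (simp add: r_def)
  moreover have "r \<le> length \<alpha>"
    using breakpoints_le[OF assms, of 1] by (simp add: r_def)
  moreover have "b = sum_list (take r \<alpha>)"
    using sums[of 0] f(3) \<open>r \<le> length \<alpha>\<close> by (simp add: r_def sum_nth_eq_sum_list_take)
  moreover have "breakpoints \<beta> (drop r \<alpha>) g"
  proof -
    have nth_g: "g ! j = f ! Suc j - r" if "j \<le> length \<beta>" for j
      using that f(1) by (simp add: g_def nth_tl)
    have ge: "r \<le> f ! Suc j" if "j \<le> length \<beta>" for j
      using sorted_wrt_nth_less[OF f(2), of 1 "Suc j"] that f(1) by (cases j) (auto simp: r_def)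
    have mono: "f ! Suc i < f ! Suc j" if "i < j" "j \<le> length \<beta>" for i j
      using sorted_wrt_nth_less[OF f(2), of "Suc i" "Suc j"] that f(1) by simp
    have len_g: "length g = Suc (length \<beta>)" using f(1) by (simp add: g_def)
    have "sorted_wrt (<) g"
      unfolding sorted_wrt_iff_nth_less
    proof (intro allI impI)
      fix i j assume "i < j" "j < length g"
      then show "g ! i < g ! j"
        using len_g ge[of i] mono[of i j] by (simp add: nth_g diff_less_mono)
    qed
    moreover have "\<beta> ! j = (\<Sum>s \<in> {g ! j ..< g ! (j + 1)}. drop r \<alpha> ! s)" if "j < length \<beta>" for j
    proof -
      have "\<beta> ! j = (\<Sum>s \<in> {g ! j + r ..< g ! (j + 1) + r}. \<alpha> ! s)"
        using sums[of "Suc j"] that ge[of j] ge[of "Suc j"] by (simp add: nth_g)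
      also have "\<dots> = (\<Sum>s \<in> {g ! j ..< g ! (j + 1)}. drop r \<alpha> ! s)"
        using \<open>r \<le> length \<alpha>\<close> by (subst sum.shift_bounds_nat_ivl) (simp add: add.commute)
      finally show ?thesis .
    qed
    ultimately show ?thesis
      using f len_g by (simp add: breakpoints_def nth_g r_def)
  qed
  ultimately show ?thesis using that by blast
qed

lemma sum_list_take_less:
  assumes "composition \<alpha>" "r < r'" "r' \<le> length \<alpha>"
  shows "sum_list (take r \<alpha>) < sum_list (take r' \<alpha>)"
proof -
  have "\<alpha> ! r \<in> set \<alpha>" using assms by simp
  then have "0 < \<alpha> ! r" using assms(1) by (auto simp: composition_def)
  then have "sum_list (take r \<alpha>) < sum_list (take (Suc r) \<alpha>)"
    using assms by (simp add: take_Suc_conv_app_nth)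
  also have "take r' \<alpha> = take (Suc r) \<alpha> @ drop (Suc r) (take r' \<alpha>)"
    using assms by (metis append_take_drop_id min.absorb1 Suc_leI take_take)
  then have "sum_list (take (Suc r) \<alpha>) \<le> sum_list (take r' \<alpha>)"
    by (metis le_add1 sum_list_append)
  finally show ?thesis .
qed

lemma composition_drop: "composition \<alpha> \<Longrightarrow> composition (drop r \<alpha>)"
  using set_drop_subset by (force simp: composition_def)

text \<open>Positive parts make the partial sums strictly increasing, so the first part of a
  coarsening determines the length \<open>r\<close> of its first block; what remains is a coarsening
  of \<open>drop r \<alpha>\<close>.\<close>

lemma bij_betw_coarsenings:
  assumes "composition \<alpha>" "\<alpha> \<noteq> []"
  shows "bij_betw (\<lambda>(r, \<beta>). sum_list (take r \<alpha>) # \<beta>)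
    (SIGMA r:{1..length \<alpha>}. {\<beta>. \<beta> \<succeq> drop r \<alpha>}) {\<beta>. \<beta> \<succeq> \<alpha>}"
  unfolding bij_betw_def
proof
  show "inj_on (\<lambda>(r, \<beta>). sum_list (take r \<alpha>) # \<beta>) (SIGMA r:{1..length \<alpha>}. {\<beta>. \<beta> \<succeq> drop r \<alpha>})"
  proof -
    have "r = r'" if "r \<in> {1..length \<alpha>}" "r' \<in> {1..length \<alpha>}"
      "sum_list (take r \<alpha>) = sum_list (take r' \<alpha>)" for r r'
      using that sum_list_take_less[OF assms(1), of r r'] sum_list_take_less[OF assms(1), of r' r]
      by (cases r r' rule: linorder_cases) auto
    then show ?thesis by (auto simp: inj_on_def)
  qed
  have pos: "0 < sum_list (take r \<alpha>)" if "0 < r" "r \<le> length \<alpha>" for r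
    using sum_list_take_less[OF assms(1) that] by simp
  show "(\<lambda>(r, \<beta>). sum_list (take r \<alpha>) # \<beta>) ` (SIGMA r:{1..length \<alpha>}. {\<beta>. \<beta> \<succeq> drop r \<alpha>}) = {\<beta>. \<beta> \<succeq> \<alpha>}"
    (is "?f ` ?A = ?B")
  proof
    show "?f ` ?A \<subseteq> ?B"
    proof (clarify)
      fix r \<beta> assume r: "r \<in> {1..length \<alpha>}" and \<beta>: "\<beta> \<succeq> drop r \<alpha>"
      then obtain f where "breakpoints \<beta> (drop r \<alpha>) f" by (auto simp: coarsens_def)
      then have "breakpoints (sum_list (take r \<alpha>) # \<beta>) \<alpha> (0 # map ((+) r) f)"
        using r by (intro breakpoints_Cons) auto
      then show "sum_list (take r \<alpha>) # \<beta> \<succeq> \<alpha>"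
        using pos[of r] r \<beta> unfolding coarsens_def by auto
    qed
    show "?B \<subseteq> ?f ` ?A"
    proof
      fix \<beta> assume \<beta>: "\<beta> \<in> ?B"
      then obtain b \<beta>' where b: "\<beta> = b # \<beta>'"
        using assms(2) coarsens_Nil_left by (cases \<beta>) auto
      then obtain f where "breakpoints (b # \<beta>') \<alpha> f" using \<beta> by (auto simp: coarsens_def)
      then obtain r where "0 < r" "r \<le> length \<alpha>" "b = sum_list (take r \<alpha>)" "\<exists>g. breakpoints \<beta>' (drop r \<alpha>) g"
        by (rule breakpoints_ConsD)
      then have "(r, \<beta>') \<in> ?A" "?f (r, \<beta>') = \<beta>"
        using \<beta> b by (auto simp: coarsens_def)
      then show "\<beta> \<in> ?f ` ?A" by force
    qed
  qed
qed

lemma the_breakpoints_Cons: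
  assumes "composition \<alpha>" "0 < r" "r \<le> length \<alpha>" "\<beta> \<succeq> drop r \<alpha>"
  shows "the_breakpoints (sum_list (take r \<alpha>) # \<beta>) \<alpha> = 0 # map ((+) r) (the_breakpoints \<beta> (drop r \<alpha>))"
  unfolding the_breakpoints_def[of "_ # _"]
proof (rule the_equality)
  show "breakpoints (sum_list (take r \<alpha>) # \<beta>) \<alpha> (0 # map ((+) r) (the_breakpoints \<beta> (drop r \<alpha>)))"
    using assms by (intro breakpoints_Cons breakpoints_the_breakpoints composition_drop)
  then show "f = 0 # map ((+) r) (the_breakpoints \<beta> (drop r \<alpha>))"
    if "breakpoints (sum_list (take r \<alpha>) # \<beta>) \<alpha> f" for f
    using breakpoints_unique[OF assms(1) that] by blast
qed

lemma block_drop: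
  assumes "r \<le> length \<alpha>"
  shows "block x c k \<alpha> (r + p) (r + q) = block x c k (drop r \<alpha>) p q"
proof -
  have "(\<Prod>s \<in> {(p + 1) + r..<q + r}. - (c k ^ (\<alpha> ! s))) = (\<Prod>s \<in> {p + 1..<q}. - (c k ^ (\<alpha> ! (s + r))))"
    by (rule prod.shift_bounds_nat_ivl)
  then show ?thesis using assms by (simp add: block_def ac_simps)
qed

lemma P_from_Nil [simp]: "P_from x c k n [] = 1"
  by (simp add: P_from_def coarsens_Nil_right)

lemma P_from_eq_0:
  assumes "n < k" "\<alpha> \<noteq> []"
  shows "P_from x c k n \<alpha> = 0"
  unfolding P_from_def
proof (intro sum.neutral ballI)
  fix \<beta> i assume \<beta>: "\<beta> \<in> {\<beta>. \<beta> \<succeq> \<alpha>}" and i: "i \<in> index_seqs_from k n (length \<beta>)"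
  then show "(\<Prod>j<length \<beta>. block x c (i ! j) \<alpha> (the_breakpoints \<beta> \<alpha> ! j) (the_breakpoints \<beta> \<alpha> ! (j + 1))) = 0"
    using assms coarsens_Nil_left by (cases \<beta>) (auto simp: index_seqs_from_empty)
qed

text \<open>Split by whether the smallest index equals k. If so, \<open>r\<close> is the length of
  the first block, and the other blocks coarsen \<open>drop r \<alpha>\<close> with indices above
  k.\<close>

lemma P_from_step:
  fixes x c :: "nat \<Rightarrow> 'a::comm_ring_1"
  assumes k: "k \<le> n" and \<alpha>: "composition \<alpha>" "\<alpha> \<noteq> []"
  shows "P_from x c k n \<alpha> = P_from x c (Suc k) n \<alpha> +
    (\<Sum>r = 1..length \<alpha>. block x c k \<alpha> 0 r * P_from x c (Suc k) n (drop r \<alpha>))"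
proof -
  define t where "t \<beta> i = (\<Prod>j<length \<beta>. block x c (i ! j) \<alpha> (the_breakpoints \<beta> \<alpha> ! j) (the_breakpoints \<beta> \<alpha> ! (j + 1)))"
    for \<beta> i
  define u where "u r \<beta> i = (\<Prod>j<length \<beta>. block x c (i ! j) (drop r \<alpha>)
      (the_breakpoints \<beta> (drop r \<alpha>) ! j) (the_breakpoints \<beta> (drop r \<alpha>) ! (j + 1)))"
    for r \<beta> i
  have sum_coarsenings: "(\<Sum>\<beta> \<in> {\<beta>. \<beta> \<succeq> \<alpha>}. h \<beta>) =
      (\<Sum>r = 1..length \<alpha>. \<Sum>\<beta> \<in> {\<beta>. \<beta> \<succeq> drop r \<alpha>}. h (sum_list (take r \<alpha>) # \<beta>))" for h :: "nat list \<Rightarrow> 'a"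
  proof -
    have "(\<Sum>\<beta> \<in> {\<beta>. \<beta> \<succeq> \<alpha>}. h \<beta>) = (\<Sum>(r, \<beta>) \<in> (SIGMA r:{1..length \<alpha>}. {\<beta>. \<beta> \<succeq> drop r \<alpha>}).
        h (sum_list (take r \<alpha>) # \<beta>))"
      by (subst sum.reindex_bij_betw[OF bij_betw_coarsenings[OF \<alpha>], symmetric])
        (simp add: case_prod_unfold)
    then show ?thesis by (simp add: sum.Sigma finite_coarsenings)
  qed
  have t: "t (sum_list (take r \<alpha>) # \<beta>) (k # i) = block x c k \<alpha> 0 r * u r \<beta> i"
    if "r \<in> {1..length \<alpha>}" "\<beta> \<succeq> drop r \<alpha>" for r \<beta> i
  proof -
    have bp: "the_breakpoints (sum_list (take r \<alpha>) # \<beta>) \<alpha> = 0 # map ((+) r) (the_breakpoints \<beta> (drop r \<alpha>))"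
      using that by (intro the_breakpoints_Cons \<alpha>) auto
    have "breakpoints \<beta> (drop r \<alpha>) (the_breakpoints \<beta> (drop r \<alpha>))"
      using that \<alpha> by (intro breakpoints_the_breakpoints composition_drop)
    then have "length (the_breakpoints \<beta> (drop r \<alpha>)) = Suc (length \<beta>)"
      "the_breakpoints \<beta> (drop r \<alpha>) ! 0 = 0" by (simp_all add: breakpoints_def)
    then show ?thesis
      using that by (simp add: t_def u_def bp prod.lessThan_Suc_shift block_drop del: prod.lessThan_Suc)
  qed
  have "P_from x c k n \<alpha> = (\<Sum>r = 1..length \<alpha>. \<Sum>\<beta> \<in> {\<beta>. \<beta> \<succeq> drop r \<alpha>}.
      (\<Sum>i \<in> index_seqs_from (Suc k) n (length \<beta>). t (sum_list (take r \<alpha>) # \<beta>) (k # i)) +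
      (\<Sum>i \<in> index_seqs_from (Suc k) n (Suc (length \<beta>)). t (sum_list (take r \<alpha>) # \<beta>) i))"
    unfolding P_from_def t_def[symmetric] sum_coarsenings
    by (simp add: sum_index_seqs_from_Suc[OF k])
  also have "\<dots> = (\<Sum>r = 1..length \<alpha>. \<Sum>\<beta> \<in> {\<beta>. \<beta> \<succeq> drop r \<alpha>}.
      \<Sum>i \<in> index_seqs_from (Suc k) n (length \<beta>). block x c k \<alpha> 0 r * u r \<beta> i) +
      P_from x c (Suc k) n \<alpha>"
    unfolding P_from_def t_def[symmetric] sum_coarsenings
    by (simp add: sum.distrib t)
  also have "\<dots> = P_from x c (Suc k) n \<alpha> +
    (\<Sum>r = 1..length \<alpha>. block x c k \<alpha> 0 r * P_from x c (Suc k) n (drop r \<alpha>))"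
    by (simp add: P_from_def u_def sum_distrib_left)
  finally show ?thesis .
qed

text \<open>
  Encode the family \<open>\<phi>\<close> as the noncommutative generating function \<open>\<Sum> \<phi>(\<alpha>) y\<^sub>\<alpha>\<close>. Then
  \<open>letter_op c\<close> is left multiplication by \<open>1 + \<Sum> c\<^sup>a y\<^sub>a\<close>, and \<open>letter_inv c\<close> is left multiplication
  by the inverse of this series.
\<close>

fun letter_op :: "'a::comm_ring_1 \<Rightarrow> (nat list \<Rightarrow> 'a) \<Rightarrow> nat list \<Rightarrow> 'a" where
  "letter_op c \<phi> [] = \<phi> []"
| "letter_op c \<phi> (a # \<alpha>) = \<phi> (a # \<alpha>) + c ^ a * \<phi> \<alpha>"

fun letter_inv :: "'a::comm_ring_1 \<Rightarrow> (nat list \<Rightarrow> 'a) \<Rightarrow> nat list \<Rightarrow> 'a" where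
  "letter_inv c \<phi> [] = \<phi> []"
| "letter_inv c \<phi> (a # \<alpha>) = \<phi> (a # \<alpha>) - c ^ a * letter_inv c \<phi> \<alpha>"

lemma letter_op_inv: "letter_op c \<circ> letter_inv c = id"
proof (intro ext)
  fix \<phi> \<alpha> show "(letter_op c \<circ> letter_inv c) \<phi> \<alpha> = id \<phi> \<alpha>"
    by (cases \<alpha>) simp_all
qed

lemma letter_inv_op: "letter_inv c \<circ> letter_op c = id"
proof (intro ext)
  fix \<phi> \<alpha> show "(letter_inv c \<circ> letter_op c) \<phi> \<alpha> = id \<phi> \<alpha>"
    by (induction \<alpha>) simp_all
qed

text \<open>The geometric series for the inverse: each of the \<open>r\<close> letters taken from
  the front contributes its negated coefficient.\<close>

lemma letter_inv_eq_sum: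
  "letter_inv c \<phi> \<alpha> = (\<Sum>r = 0..length \<alpha>. (\<Prod>s<r. - (c ^ (\<alpha> ! s))) * \<phi> (drop r \<alpha>))"
proof (induction \<alpha>)
  case (Cons a \<alpha>)
  have "(\<Sum>r = 0..length (a # \<alpha>). (\<Prod>s<r. - (c ^ ((a # \<alpha>) ! s))) * \<phi> (drop r (a # \<alpha>))) =
    \<phi> (a # \<alpha>) + (\<Sum>r = 0..length \<alpha>. (\<Prod>s<Suc r. - (c ^ ((a # \<alpha>) ! s))) * \<phi> (drop r \<alpha>))"
    by (simp add: sum.atLeast0_atMost_Suc_shift del: sum.atLeast0_atMost_Suc sum.cl_ivl_Suc prod.lessThan_Suc)
  also have "\<dots> = \<phi> (a # \<alpha>) - c ^ a * letter_inv c \<phi> \<alpha>"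
    by (simp add: Cons prod.lessThan_Suc_shift sum_distrib_left sum_negf mult.assoc del: prod.lessThan_Suc)
  finally show ?case by simp
qed simp

text \<open>The coefficient at \<open>a # \<alpha>\<close> in X_k N_k^{-1} Phi = Phi + (X_k - N_k)
  N_k^{-1} Phi, where Phi is the series for the indices k+1, ..., n.\<close>

lemma P_from_Cons:
  assumes "k \<le> n" "composition (a # \<alpha>)"
  shows "P_from x c k n (a # \<alpha>) = P_from x c (Suc k) n (a # \<alpha>) +
    (x k ^ a - c k ^ a) * letter_inv (c k) (P_from x c (Suc k) n) \<alpha>"
proof -
  have b: "block x c k (a # \<alpha>) 0 (Suc r) = (x k ^ a - c k ^ a) * (\<Prod>s<r. - (c k ^ (\<alpha> ! s)))" for r
    by (simp add: block_def prod.atLeast_Suc_lessThan_Suc_shift atLeast0LessThan del: prod.op_ivl_Suc)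
  have "(\<Sum>r = 1..length (a # \<alpha>). block x c k (a # \<alpha>) 0 r * P_from x c (Suc k) n (drop r (a # \<alpha>))) =
    (\<Sum>r = 0..length \<alpha>. block x c k (a # \<alpha>) 0 (Suc r) * P_from x c (Suc k) n (drop r \<alpha>))"
    by (simp add: sum.atLeast_Suc_atMost_Suc_shift del: sum.cl_ivl_Suc)
  then show ?thesis
    by (subst P_from_step[OF assms]) (simp_all add: b letter_inv_eq_sum sum_distrib_left mult.assoc)
qed

subsection \<open>The leading form of \<open>P\<^sub>\<alpha>\<close>\<close>

text \<open>The corrections in \<open>letter_inv\<close> replace letters by constants, and letters
  of a composition are positive, so each correction loses degree.\<close>

lemma letter_inv_deg_lt:
  assumes "\<And>\<gamma>. composition \<gamma> \<Longrightarrow> \<phi> \<gamma> \<in> deg_lt (Suc (sum_list \<gamma>))" "composition \<alpha>"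
  shows "letter_inv (of_nat k) \<phi> \<alpha> \<in> deg_lt (Suc (sum_list \<alpha>))"
    "letter_inv (of_nat k) \<phi> \<alpha> - \<phi> \<alpha> \<in> deg_lt (sum_list \<alpha>)"
proof -
  have const: "of_nat k ^ a * p \<in> deg_lt d" if "p \<in> deg_lt d" for a d p
  proof -
    have "(of_nat k ^ a :: mpoly) = Poly_Mapping.single 0 (of_nat (k ^ a))"
      by (metis of_nat_power single_of_nat)
    then show ?thesis using deg_lt_mult[OF const_in_deg_lt[of _ 0] that] by simp
  qed
  have "letter_inv (of_nat k) \<phi> \<alpha> \<in> deg_lt (Suc (sum_list \<alpha>)) \<and>
    letter_inv (of_nat k) \<phi> \<alpha> - \<phi> \<alpha> \<in> deg_lt (sum_list \<alpha>)"
    using assms(2)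
  proof (induction \<alpha>)
    case Nil
    then show ?case using assms(1)[of "[]"] by simp
  next
    case (Cons a \<alpha>)
    then have "of_nat k ^ a * letter_inv (of_nat k) \<phi> \<alpha> \<in> deg_lt (sum_list (a # \<alpha>))"
      using deg_lt_mono[of "Suc (sum_list \<alpha>)" "sum_list (a # \<alpha>)"] by (intro const) auto
    moreover have "deg_lt (sum_list (a # \<alpha>)) \<subseteq> deg_lt (Suc (sum_list (a # \<alpha>)))" by (rule deg_lt_mono) simp
    moreover have "\<phi> (a # \<alpha>) \<in> deg_lt (Suc (sum_list (a # \<alpha>)))" using Cons assms(1) by blast
    ultimately show ?case
      using deg_lt_diff[of "\<phi> (a # \<alpha>)" "Suc (sum_list (a # \<alpha>))"]
      by (auto simp del: sum_list.Cons intro: deg_lt_uminus)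
  qed
  then show "letter_inv (of_nat k) \<phi> \<alpha> \<in> deg_lt (Suc (sum_list \<alpha>))"
    "letter_inv (of_nat k) \<phi> \<alpha> - \<phi> \<alpha> \<in> deg_lt (sum_list \<alpha>)" by auto
qed

text \<open>Compare \<open>P_from_Cons\<close> with \<open>M_from_Cons\<close>: the summand with k^a
  and the corrections in \<open>letter_inv\<close> have smaller degree, which leaves x_k^a times the
  tail.\<close>

lemma P_from_minus_M_from_deg_lt:
  assumes "composition \<alpha>"
  shows "P_from Var of_nat k n \<alpha> - M_from k n \<alpha> \<in> deg_lt (sum_list \<alpha>)"
  using assms
proof (induction "Suc n - k" arbitrary: k \<alpha>)
  case (0 k \<alpha>)
  then show ?case by (cases \<alpha>) (simp_all add: P_from_eq_0 M_from_eq_0)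
next
  case (Suc d k \<alpha>)
  show ?case
  proof (cases \<alpha>)
    case (Cons a \<alpha>')
    let ?P = "P_from Var of_nat (Suc k) n" and ?M = "M_from (Suc k) n"
    define L where "L = letter_inv (of_nat k) ?P \<alpha>'"
    have k: "k \<le> n" "d = Suc n - Suc k" using Suc.hyps(2) by auto
    have IH: "?P \<gamma> - ?M \<gamma> \<in> deg_lt (sum_list \<gamma>)" if "composition \<gamma>" for \<gamma>
      using Suc.hyps(1)[OF k(2) that] .
    have "?P \<gamma> \<in> deg_lt (Suc (sum_list \<gamma>))" if "composition \<gamma>" for \<gamma>
      using deg_lt_add[of "?P \<gamma> - ?M \<gamma>" "Suc (sum_list \<gamma>)" "?M \<gamma>"] IH[OF that]
        deg_lt_mono[of "sum_list \<gamma>" "Suc (sum_list \<gamma>)"] M_from_deg_lt[of "Suc k" n \<gamma>] by auto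
    then have L: "L \<in> deg_lt (Suc (sum_list \<alpha>'))" "L - ?P \<alpha>' \<in> deg_lt (sum_list \<alpha>')"
      using letter_inv_deg_lt Suc.prems Cons unfolding L_def by (metis composition_Cons)+
    have "L - ?P \<alpha>' + (?P \<alpha>' - ?M \<alpha>') \<in> deg_lt (sum_list \<alpha>')"
      using L(2) IH[of \<alpha>'] Suc.prems Cons by (intro deg_lt_add) auto
    then have "L - ?M \<alpha>' \<in> deg_lt (sum_list \<alpha>')" by simp
    then have 1: "Var k ^ a * (L - ?M \<alpha>') \<in> deg_lt (sum_list \<alpha>)"
      using deg_lt_mult[OF deg_lt_Var_power] Cons by simp
    have "(of_nat k ^ a :: mpoly) = Poly_Mapping.single 0 (of_nat (k ^ a))"
      by (metis of_nat_power single_of_nat)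
    then have "of_nat k ^ a * L \<in> deg_lt (0 + Suc (sum_list \<alpha>'))"
      using deg_lt_mult[OF const_in_deg_lt L(1)] by metis
    then have 2: "of_nat k ^ a * L \<in> deg_lt (sum_list \<alpha>)"
      using deg_lt_mono[of "Suc (sum_list \<alpha>')" "sum_list \<alpha>"] Suc.prems Cons by auto
    have "P_from Var of_nat k n \<alpha> - M_from k n \<alpha> =
        (?P \<alpha> - ?M \<alpha>) + (Var k ^ a * (L - ?M \<alpha>') - of_nat k ^ a * L)"
      using k Suc.prems Cons by (simp add: P_from_Cons M_from_Cons L_def algebra_simps)
    moreover have "\<dots> \<in> deg_lt (sum_list \<alpha>)"
      using 1 2 IH[OF Suc.prems] deg_lt_add deg_lt_diff by blast
    ultimately show ?thesis by simp
  qed simp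
qed

lemma P_minus_M_deg_lt: "composition \<alpha> \<Longrightarrow> P n \<alpha> - M n \<alpha> \<in> deg_lt (sum_list \<alpha>)"
  by (simp add: P_eq_P_from M_eq_M_from P_from_minus_M_from_deg_lt)

subsection \<open>Noncrossing partitions\<close>

lemma noncrossing_arcD:
  "noncrossing n \<Lambda> \<Longrightarrow> (i, j) \<in> \<Lambda> \<Longrightarrow> 1 \<le> i \<and> i < j \<and> j \<le> n"
  by (auto simp: noncrossing_def)

lemma noncrossing_no_crossing:
  "noncrossing n \<Lambda> \<Longrightarrow> (i, k) \<in> \<Lambda> \<Longrightarrow> (j, l) \<in> \<Lambda> \<Longrightarrow> (i, k) \<noteq> (j, l) \<Longrightarrow> i \<le> j \<Longrightarrow> j < k \<Longrightarrow> k \<le> l \<Longrightarrow> False"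
  unfolding noncrossing_def by blast

text \<open>The outer inequalities in \<open>noncrossing\<close> are weak, so two arcs with a common
  left endpoint count as crossing, and likewise for right endpoints. An index therefore starts at
  most one arc and ends at most one.\<close>

lemma noncrossing_unique_right:
  assumes "noncrossing n \<Lambda>" "(i, k) \<in> \<Lambda>" "(i, k') \<in> \<Lambda>"
  shows "k = k'"
proof (rule ccontr)
  assume "k \<noteq> k'"
  then show False
    using noncrossing_no_crossing[OF assms(1), of i k i k'] noncrossing_no_crossing[OF assms(1), of i k' i k]
      assms noncrossing_arcD[OF assms(1)] by (metis le_refl linorder_le_cases prod.inject)
qed

lemma noncrossing_unique_left:
  assumes "noncrossing n \<Lambda>" "(i, k) \<in> \<Lambda>" "(i', k) \<in> \<Lambda>"
  shows "i = i'"
proof (rule ccontr)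
  assume "i \<noteq> i'"
  then show False
    using noncrossing_no_crossing[OF assms(1), of i k i' k] noncrossing_no_crossing[OF assms(1), of i' k i k]
      assms noncrossing_arcD[OF assms(1)] by (metis le_refl linorder_le_cases prod.inject)
qed

lemma finite_noncrossing: "noncrossing n \<Lambda> \<Longrightarrow> finite \<Lambda>"
  by (rule finite_subset[of _ "{1..n} \<times> {1..n}"]) (fastforce dest: noncrossing_arcD)+

lemma arc_component_eq:
  assumes "(i, j) \<in> \<Lambda>"
  shows "arc_component \<Lambda> i = arc_component \<Lambda> j"
proof -
  have "(i, j) \<in> (\<Lambda> \<union> \<Lambda>\<inverse>)\<^sup>*" "(j, i) \<in> (\<Lambda> \<union> \<Lambda>\<inverse>)\<^sup>*" using assms by auto
  then show ?thesis unfolding arc_component_def by (auto intro: rtrancl_trans)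
qed

text \<open>A component is a chain of arcs, and an index that starts no arc is its right end: from
  every element, arcs lead rightwards to \<open>j\<close>.\<close>

lemma arc_component_le:
  assumes \<Lambda>: "noncrossing n \<Lambda>" and no_arc: "\<And>k. (j, k) \<notin> \<Lambda>" and k: "k \<in> arc_component \<Lambda> j"
  shows "k \<le> j"
proof -
  have "(k, j) \<in> \<Lambda>\<^sup>*"
    using k unfolding arc_component_def mem_Collect_eq
  proof (induction rule: rtrancl_induct)
    case (step k k')
    \<comment> \<open>A forward step must follow the first arc of the path to \<open>j\<close>, by
      uniqueness; a backward step lengthens that path.\<close>
    from step.hyps(2) show ?case
    proof
      assume k: "(k, k') \<in> \<Lambda>"
      from step.IH show ?thesis
      proof (cases rule: converse_rtranclE)
        case base
        then show ?thesis using k no_arc by blast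
      next
        case (step y)
        then show ?thesis using noncrossing_unique_right[OF \<Lambda> k] by blast
      qed
    next
      assume "(k, k') \<in> \<Lambda>\<inverse>"
      then show ?thesis using step.IH by (simp add: converse_rtrancl_into_rtrancl)
    qed
  qed simp
  then show ?thesis
    by (induction rule: converse_rtrancl_induct) (use noncrossing_arcD[OF \<Lambda>] in force)+
qed

definition block_max :: "(nat \<times> nat) set \<Rightarrow> nat \<Rightarrow> nat" where
  "block_max \<Lambda> j = Max (arc_component \<Lambda> j)"

lemma block_max_no_arc:
  assumes "noncrossing n \<Lambda>" "\<And>k. (j, k) \<notin> \<Lambda>"
  shows "block_max \<Lambda> j = j"
  unfolding block_max_def
proof (rule Max_eqI)
  show "finite (arc_component \<Lambda> j)"
    using arc_component_le[OF assms] by (auto simp: finite_nat_set_iff_bounded_le)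
qed (use arc_component_le[OF assms] in \<open>auto simp: arc_component_def\<close>)

lemma Q_arc: "noncrossing n \<Lambda> \<Longrightarrow> (i, j) \<in> \<Lambda> \<Longrightarrow> Q \<Lambda> j = i"
  unfolding Q_def using noncrossing_unique_left by (auto intro!: the_equality)

lemma Q_no_arc: "(\<And>i. (i, j) \<notin> \<Lambda>) \<Longrightarrow> Q \<Lambda> j = block_max \<Lambda> j"
  by (simp add: Q_def block_max_def)

text \<open>Without an arc ending at \<open>j\<close>, \<open>Q\<close> takes the maximum of a
  finite set containing \<open>j\<close>. So the arcs can be read off from the values below the
  diagonal.\<close>

lemma Q_arc_iff:
  assumes "noncrossing n \<Lambda>"
  shows "(i, j) \<in> \<Lambda> \<longleftrightarrow> Q \<Lambda> j = i \<and> i < j"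
proof
  assume "Q \<Lambda> j = i \<and> i < j"
  moreover have "j \<le> Q \<Lambda> j" if "\<And>i. (i, j) \<notin> \<Lambda>"
  proof -
    have "arc_component \<Lambda> j \<subseteq> insert j (Field \<Lambda>)"
    proof
      fix k assume "k \<in> arc_component \<Lambda> j"
      then have "(j, k) \<in> (\<Lambda> \<union> \<Lambda>\<inverse>)\<^sup>*" by (simp add: arc_component_def)
      then show "k \<in> insert j (Field \<Lambda>)" by (cases rule: rtranclE) (auto simp: Field_def)
    qed
    then have "finite (arc_component \<Lambda> j)"
      using finite_noncrossing[OF assms] by (meson finite_Field finite_insert finite_subset)
    then show ?thesis
      using that by (auto simp: Q_no_arc block_max_def arc_component_def intro!: Max_ge)
  qed
  ultimately show "(i, j) \<in> \<Lambda>" using Q_arc[OF assms] by (metis not_le)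
qed (use assms Q_arc noncrossing_arcD in blast)

lemma Q_outside:
  assumes "noncrossing n \<Lambda>" "j \<notin> {1..n}"
  shows "Q \<Lambda> j = j"
proof -
  have "(i, j) \<notin> \<Lambda>" "(j, i) \<notin> \<Lambda>" for i
    using noncrossing_arcD[OF assms(1), of i j] noncrossing_arcD[OF assms(1), of j i] assms(2) by auto
  then show ?thesis by (simp add: Q_no_arc block_max_no_arc[OF assms(1)])
qed

lemma finite_QSV: "finite (QSV n)"
proof -
  have "QSV n \<subseteq> Q ` Pow ({1..n} \<times> {1..n})"
    using noncrossing_arcD unfolding QSV_def by fastforce
  then show ?thesis by (rule finite_subset) auto
qed

subsection \<open>The telescoping product\<close>

definition compose_list :: "('a \<Rightarrow> 'a) list \<Rightarrow> 'a \<Rightarrow> 'a" where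
  "compose_list fs = foldr (\<circ>) fs id"

lemma compose_list_simps [simp]: "compose_list [] = id" "compose_list (f # fs) = f \<circ> compose_list fs"
  by (simp_all add: compose_list_def)

lemma compose_list_append [simp]: "compose_list (fs @ gs) = compose_list fs \<circ> compose_list gs"
  by (induction fs) (simp_all add: comp_assoc)

lemma sorted_list_of_set_insert_max:
  assumes "finite A" "\<And>a. a \<in> A \<Longrightarrow> a < x"
  shows "sorted_list_of_set (insert x A) = sorted_list_of_set A @ [x]"
  using assms by (intro sorted_distinct_set_unique) (auto simp: sorted_append less_imp_le
    simp del: sorted_list_of_set_insert_remove)

text \<open>
  An arc \<open>(i, k)\<close> is open at \<open>m\<close> if \<open>i \<le> m < k\<close>. Open arcs are nested, so the one that starts last is
  the one that ends first. After the factors with index at most \<open>m\<close> have been multiplied, what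
  survives of each block is the pair formed by its maximum and the start of its open arc.
\<close>

lemma telescope_noncrossing:
  fixes g g' :: "nat \<Rightarrow> 'a \<Rightarrow> 'a"
  assumes \<Lambda>: "noncrossing n \<Lambda>"
    and inverse: "\<And>k. g k \<circ> g' k = id" "\<And>k. g' k \<circ> g k = id"
  shows "compose_list (map (\<lambda>k. g (Q \<Lambda> k) \<circ> g' k) [1..<Suc n]) = id"
proof -
  define starts where "starts m = {i. i \<le> m \<and> (\<exists>k > m. (i, k) \<in> \<Lambda>)}" for m
  define h where "h i = g (block_max \<Lambda> i) \<circ> g' i" for i
  have fin [simp]: "finite (starts m)" for m by (simp add: starts_def)
  have "compose_list (map (\<lambda>k. g (Q \<Lambda> k) \<circ> g' k) [1..<Suc m]) = compose_list (map h (sorted_list_of_set (starts m)))"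
    for m
  proof (induction m)
    case 0
    have "starts 0 = {}" using noncrossing_arcD[OF \<Lambda>] by (fastforce simp: starts_def)
    then show ?case by simp
  next
    case (Suc m)
    let ?j = "Suc m"
    have upt_split: "[1..<Suc ?j] = [1..<?j] @ [?j]" by simp
    \<comment> \<open>\<open>O'\<close> holds the starts that remain open once the arc ending at
      \<open>?j\<close>, if any, is closed; \<open>?j\<close> may then open a new one. If it opens
      none, it is the maximum of its block and \<open>h ?j\<close> is \<open>id\<close>.\<close>
    obtain O' where O': "\<And>a. a \<in> O' \<Longrightarrow> a < ?j" "finite O'"
      "starts ?j = O' \<union> (if \<exists>k. (?j, k) \<in> \<Lambda> then {?j} else {})"
      "compose_list (map h (sorted_list_of_set (starts m))) \<circ> (g (Q \<Lambda> ?j) \<circ> g' ?j) =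
       compose_list (map h (sorted_list_of_set O')) \<circ> h ?j"
    proof (cases "\<exists>i. (i, ?j) \<in> \<Lambda>")
      case True
      then obtain i where i: "(i, ?j) \<in> \<Lambda>" by blast
      define O' where "O' = starts m - {i}"
      have "i \<in> starts m" using i noncrossing_arcD[OF \<Lambda> i] by (auto simp: starts_def)
      then have starts: "starts m = insert i O'" by (auto simp: O'_def)
      \<comment> \<open>The arc closing at \<open>?j\<close> was opened last, since one opened later
        would cross it. So \<open>h i\<close> is the last factor, and its \<open>g' i\<close> meets
        the incoming \<open>g i\<close>.\<close>
      have "a < i" if a: "a \<in> O'" for a
      proof (rule ccontr)
        assume "\<not> a < i"
        moreover obtain k where k: "(a, k) \<in> \<Lambda>" "m < k" "a \<le> m" "a \<noteq> i"
          using a by (auto simp: O'_def starts_def)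
        ultimately show False
          using noncrossing_no_crossing[OF \<Lambda> i k(1)] by auto
      qed
      then have "sorted_list_of_set (starts m) = sorted_list_of_set O' @ [i]"
        unfolding starts by (intro sorted_list_of_set_insert_max) (simp_all add: O'_def)
      moreover have "block_max \<Lambda> i = block_max \<Lambda> ?j"
        using arc_component_eq[OF i] by (simp add: block_max_def)
      ultimately have "compose_list (map h (sorted_list_of_set (starts m))) \<circ> (g (Q \<Lambda> ?j) \<circ> g' ?j) =
          compose_list (map h (sorted_list_of_set O')) \<circ> (g (block_max \<Lambda> ?j) \<circ> (g' i \<circ> g i) \<circ> g' ?j)"
        using Q_arc[OF \<Lambda> i] by (simp add: h_def comp_assoc)
      then have 1: "compose_list (map h (sorted_list_of_set (starts m))) \<circ> (g (Q \<Lambda> ?j) \<circ> g' ?j) =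
          compose_list (map h (sorted_list_of_set O')) \<circ> h ?j"
        by (simp add: inverse h_def)
      have "starts ?j = O' \<union> (if \<exists>k. (?j, k) \<in> \<Lambda> then {?j} else {})"
      proof (intro Set.set_eqI iffI)
        fix a assume "a \<in> starts ?j"
        then obtain k where k: "a \<le> ?j" "?j < k" "(a, k) \<in> \<Lambda>" by (auto simp: starts_def)
        then show "a \<in> O' \<union> (if \<exists>k. (?j, k) \<in> \<Lambda> then {?j} else {})"
          using noncrossing_unique_right[OF \<Lambda> i, of k] by (cases "a = ?j") (auto simp: O'_def starts_def intro: exI[of _ k])
      next
        fix a assume a: "a \<in> O' \<union> (if \<exists>k. (?j, k) \<in> \<Lambda> then {?j} else {})"
        show "a \<in> starts ?j"
        proof (cases "a = ?j")
          case True
          then have "\<exists>k. (?j, k) \<in> \<Lambda>" using a by (auto simp: O'_def starts_def split: if_splits)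
          then show ?thesis using True noncrossing_arcD[OF \<Lambda>] by (auto simp: starts_def)
        next
          case False
          then obtain k where k: "a \<le> m" "m < k" "(a, k) \<in> \<Lambda>" "a \<noteq> i"
            using a by (auto simp: O'_def starts_def split: if_splits)
          then have "k \<noteq> ?j" using noncrossing_unique_left[OF \<Lambda> i] by blast
          then show ?thesis using k by (auto simp: starts_def intro!: exI[of _ k])
        qed
      qed
      then show ?thesis using that[of O'] 1 by (auto simp: O'_def starts_def)
    next
      case False
      have "starts ?j = starts m \<union> (if \<exists>k. (?j, k) \<in> \<Lambda> then {?j} else {})"
      proof (intro Set.set_eqI iffI)
        fix a assume "a \<in> starts ?j"
        then show "a \<in> starts m \<union> (if \<exists>k. (?j, k) \<in> \<Lambda> then {?j} else {})"
          by (cases "a = ?j") (auto simp: starts_def intro: Suc_lessD)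
      next
        fix a assume a: "a \<in> starts m \<union> (if \<exists>k. (?j, k) \<in> \<Lambda> then {?j} else {})"
        show "a \<in> starts ?j"
        proof (cases "a = ?j")
          case True
          then have "\<exists>k. (?j, k) \<in> \<Lambda>" using a by (auto simp: starts_def split: if_splits)
          then show ?thesis using True noncrossing_arcD[OF \<Lambda>] by (auto simp: starts_def)
        next
          case ne: False
          then obtain k where k: "a \<le> m" "m < k" "(a, k) \<in> \<Lambda>"
            using a by (auto simp: starts_def split: if_splits)
          then have "k \<noteq> ?j" using False by blast
          then show ?thesis using k by (auto simp: starts_def intro!: exI[of _ k])
        qed
      qed
      then show ?thesis using that[of "starts m"] False Q_no_arc[of ?j \<Lambda>]
        by (auto simp: h_def starts_def)
    qed
    have "compose_list (map (\<lambda>k. g (Q \<Lambda> k) \<circ> g' k) [1..<Suc ?j]) = compose_list (map h (sorted_list_of_set O')) \<circ> h ?j"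
      using Suc.IH O'(4) by (simp only: upt_split map_append compose_list_append) simp
    also have "\<dots> = compose_list (map h (sorted_list_of_set (starts ?j)))"
    proof (cases "\<exists>k. (?j, k) \<in> \<Lambda>")
      case True
      then have "sorted_list_of_set (starts ?j) = sorted_list_of_set O' @ [?j]"
        using O' sorted_list_of_set_insert_max[of O' ?j] by simp
      then show ?thesis by simp
    next
      case False
      then have "h ?j = id" using block_max_no_arc[OF \<Lambda>, of ?j] inverse by (simp add: h_def)
      then show ?thesis using False O'(3) by simp
    qed
    finally show ?case .
  qed
  moreover have "starts n = {}" using noncrossing_arcD[OF \<Lambda>] by (fastforce simp: starts_def)
  ultimately show ?thesis by simp
qed

text \<open>The recursion for \<open>P_from\<close> is available at compositions only; tails of
  compositions are compositions, so \<open>letter_inv\<close> respects this restriction.\<close>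

lemma letter_inv_cong:
  assumes "\<And>\<gamma>. composition \<gamma> \<Longrightarrow> \<phi> \<gamma> = \<psi> \<gamma>" "composition \<alpha>"
  shows "letter_inv c \<phi> \<alpha> = letter_inv c \<psi> \<alpha>"
  using assms(2) by (induction \<alpha>) (simp_all add: assms(1))

text \<open>The product formula: the indicator of the empty word is the series 1, and by
  \<open>P_from_Cons\<close> each index k multiplies from the left by X_k N_k^{-1}.\<close>

lemma P_from_eq_compose_list:
  fixes x c :: "nat \<Rightarrow> 'a::comm_ring_1"
  assumes "composition \<alpha>" "k \<le> Suc n"
  shows "P_from x c k n \<alpha> =
    compose_list (map (\<lambda>k. letter_op (x k) \<circ> letter_inv (c k)) [k..<Suc n]) (\<lambda>\<alpha>. if \<alpha> = [] then 1 else 0) \<alpha>"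
proof -
  define f where "f k = letter_op (x k) \<circ> letter_inv (c k)" for k
  have "P_from x c k n \<alpha> = compose_list (map f [k..<Suc n]) (\<lambda>\<alpha>. if \<alpha> = [] then 1 else 0) \<alpha>"
    using assms(2,1)
  proof (induction k arbitrary: \<alpha> rule: inc_induct)
    case base
    then show ?case by (cases \<alpha>) (simp_all add: P_from_eq_0)
  next
    case (step k)
    let ?\<phi> = "compose_list (map f [Suc k..<Suc n]) (\<lambda>\<alpha>. if \<alpha> = [] then 1 else 0)"
    have upt: "[k..<Suc n] = k # [Suc k..<Suc n]" using step by (simp add: upt_rec)
    show ?case
    proof (cases \<alpha>)
      case Nil
      then show ?thesis using step.IH[of "[]"] unfolding upt by (simp add: f_def del: upt_Suc)
    next
      case (Cons a \<alpha>')
      have "letter_inv (c k) (P_from x c (Suc k) n) \<alpha>' = letter_inv (c k) ?\<phi> \<alpha>'"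
        by (rule letter_inv_cong[OF step.IH]) (use step.prems Cons in auto)
      then have "P_from x c k n \<alpha> = ?\<phi> \<alpha> + (x k ^ a - c k ^ a) * letter_inv (c k) ?\<phi> \<alpha>'"
        using step.hyps step.prems step.IH[OF step.prems] Cons by (simp add: P_from_Cons del: upt_Suc)
      also have "\<dots> = f k ?\<phi> \<alpha>" using Cons by (simp add: f_def algebra_simps del: upt_Suc)
      finally show ?thesis by (simp add: upt del: upt_Suc)
    qed
  qed
  then show ?thesis by (simp add: f_def[abs_def] del: upt_Suc)
qed

lemma P_vanishes_on_QSV:
  assumes "composition \<alpha>" "\<alpha> \<noteq> []" "\<sigma> \<in> QSV n"
  shows "eval (\<lambda>i. of_nat (\<sigma> i)) (P n \<alpha>) = 0"
proof -
  obtain \<Lambda> where \<Lambda>: "noncrossing n \<Lambda>" "\<sigma> = Q \<Lambda>" using assms(3) by (auto simp: QSV_def)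
  have "compose_list (map (\<lambda>k. letter_op (of_nat (\<sigma> k) :: rat) \<circ> letter_inv (of_nat k)) [1..<Suc n]) = id"
    unfolding \<Lambda>(2)
    by (rule telescope_noncrossing[OF \<Lambda>(1), where g = "\<lambda>k. letter_op (of_nat k)" and g' = "\<lambda>k. letter_inv (of_nat k)"])
      (simp_all add: letter_op_inv letter_inv_op)
  \<comment> \<open>The series at this point is 1, whose coefficient at a nonempty word is
    0.\<close>
  then show ?thesis
    using assms by (simp add: eval_P P_from_eq_compose_list del: upt_Suc)
qed

subsection \<open>Subdiagonal monomials and noncrossing partitions\<close>

text \<open>
  The exponents of a subdiagonal monomial steer a stack: step \<open>j\<close> pops as many elements as the
  exponent of \<open>x\<^sub>j\<close> says, joins the last popped element to \<open>j\<close> by an arc, and pushes \<open>j\<close>.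
\<close>

fun stack :: "(nat \<Rightarrow> nat) \<Rightarrow> nat \<Rightarrow> nat list" where
  "stack e 0 = []"
| "stack e (Suc j) = Suc j # drop (e (Suc j)) (stack e j)"

definition arcs :: "(nat \<Rightarrow> nat) \<Rightarrow> nat \<Rightarrow> (nat \<times> nat) set" where
  "arcs e n = {(stack e j ! (e (Suc j) - 1), Suc j) | j. j < n \<and> 0 < e (Suc j)}"

lemma in_arcs_iff:
  "(i, Suc j) \<in> arcs e n \<longleftrightarrow> j < n \<and> 0 < e (Suc j) \<and> i = stack e j ! (e (Suc j) - 1)"
  by (auto simp: arcs_def)

lemma arcs_Suc: "arcs e (Suc n) =
    (if e (Suc n) = 0 then arcs e n else insert (stack e n ! (e (Suc n) - 1), Suc n) (arcs e n))"
  by (auto simp: arcs_def less_Suc_eq)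

definition subdiagonal_seq :: "nat \<Rightarrow> (nat \<Rightarrow> nat) \<Rightarrow> bool" where
  "subdiagonal_seq n e \<longleftrightarrow> (\<forall>i \<in> {1..n}. (\<Sum>k = 1..i. e k) < i)"

text \<open>Each step pushes one element and pops as many as the exponent says; subdiagonality
  ensures that \<open>drop\<close> never asks for more than the stack holds.\<close>

lemma length_stack:
  assumes "subdiagonal_seq n e" "j \<le> n"
  shows "length (stack e j) + (\<Sum>k = 1..j. e k) = j"
  using assms(2)
proof (induction j)
  case (Suc j)
  have "(\<Sum>k = 1..Suc j. e k) < Suc j"
    using assms(1) Suc.prems unfolding subdiagonal_seq_def by (metis atLeastAtMost_iff le_add1 plus_1_eq_Suc)
  then show ?case using Suc by simp
qed simp

lemma pop_le_length_stack:
  assumes "subdiagonal_seq n e" "j < n"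
  shows "e (Suc j) \<le> length (stack e j)"
proof -
  have "(\<Sum>k = 1..Suc j. e k) < Suc j"
    using assms unfolding subdiagonal_seq_def by (metis Suc_leI atLeastAtMost_iff le_add1 plus_1_eq_Suc)
  then show ?thesis using length_stack[OF assms(1), of j] assms(2) by simp
qed

lemma sorted_stack: "sorted_wrt (>) (stack e j) \<and> set (stack e j) \<subseteq> {1..j}"
proof (induction j)
  case (Suc j)
  then show ?case
    using set_drop_subset[of "e (Suc j)" "stack e j"]
    by (force simp: sorted_wrt_drop)
qed simp

lemma distinct_stack: "distinct (stack e j)"
  using sorted_stack[of e j] by (metis distinct_rev sorted_wrt_rev strict_sorted_iff)

text \<open>The second conjunct is the invariant that drives the induction: no stack element lies
  under an arc, so an arc from a stack element to \<open>Suc j\<close> crosses nothing.\<close>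

lemma noncrossing_arcs:
  assumes "subdiagonal_seq n e" "j \<le> n"
  shows "noncrossing j (arcs e j) \<and> (\<forall>s \<in> set (stack e j). \<forall>(i, k) \<in> arcs e j. \<not> (i \<le> s \<and> s < k))"
  using assms(2)
proof (induction j)
  case 0
  then show ?case by (simp add: arcs_def noncrossing_def)
next
  case (Suc j)
  let ?p = "e (Suc j)"
  have IH: "noncrossing j (arcs e j)"
    "\<And>s i k. s \<in> set (stack e j) \<Longrightarrow> (i, k) \<in> arcs e j \<Longrightarrow> i \<le> s \<Longrightarrow> s < k \<Longrightarrow> False"
    using Suc by auto
  have arc: "1 \<le> i \<and> i < k \<and> k \<le> j" if "(i, k) \<in> arcs e j" for i k
    using noncrossing_arcD[OF IH(1) that] .
  have no: "False" if "(i, k) \<in> arcs e j" "(i', k') \<in> arcs e j" "(i, k) \<noteq> (i', k')" "i \<le> i'" "i' < k" "k \<le> k'"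
    for i k i' k'
    using noncrossing_no_crossing[OF IH(1) that] .
  have rest: "set (drop ?p (stack e j)) \<subseteq> set (stack e j)" by (rule set_drop_subset)
  show ?case
  proof (cases "?p = 0")
    case True
    have "noncrossing (Suc j) (arcs e j)"
      using IH(1) unfolding noncrossing_def by auto
    moreover have "\<not> (i \<le> s \<and> s < k)" if "s \<in> set (stack e (Suc j))" "(i, k) \<in> arcs e j" for s i k
      using that True arc[OF that(2)] IH(2)[of s i k] by auto
    moreover have "arcs e (Suc j) = arcs e j" using True by (simp add: arcs_Suc)
    ultimately show ?thesis by auto
  next
    case False
    define s where "s = stack e j ! (?p - 1)"
    have p: "?p - 1 < length (stack e j)"
      using pop_le_length_stack[OF assms(1), of j] Suc.prems False by simp
    then have s_in: "s \<in> set (stack e j)" by (simp add: s_def)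
    then have s: "1 \<le> s" "s \<le> j" using sorted_stack[of e j] by fastforce+
    \<comment> \<open>The stack is decreasing, so what survives the pop lies to the left of the new
      arc.\<close>
    have below: "s' < s" if "s' \<in> set (drop ?p (stack e j))" for s'
    proof -
      have "\<exists>q < length (drop ?p (stack e j)). drop ?p (stack e j) ! q = s'"
        using that unfolding in_set_conv_nth .
      then obtain q where "q < length (drop ?p (stack e j))" "s' = drop ?p (stack e j) ! q"
        by blast
      then have "s' = stack e j ! (?p + q)" "?p + q < length (stack e j)" by auto
      then show ?thesis
        using sorted_stack[of e j] sorted_wrt_nth_less[of "(>)" "stack e j" "?p - 1" "?p + q"] False
        by (simp add: s_def)
    qed
    have arcs: "arcs e (Suc j) = insert (s, Suc j) (arcs e j)"
      using False by (simp add: arcs_Suc s_def)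
    have arc': "1 \<le> i \<and> i < k \<and> k \<le> Suc j" if "(i, k) \<in> arcs e (Suc j)" for i k
      using that arc[of i k] s by (auto simp: arcs)
    have "noncrossing (Suc j) (arcs e (Suc j))"
      unfolding noncrossing_def
    proof (intro conjI notI)
      show "\<forall>(i, k) \<in> arcs e (Suc j). 1 \<le> i \<and> i < k \<and> k \<le> Suc j"
        using arc' by blast
      assume "\<exists>i i' k k'. (i, k) \<in> arcs e (Suc j) \<and> (i', k') \<in> arcs e (Suc j) \<and> (i, k) \<noteq> (i', k') \<and>
        i \<le> i' \<and> i' < k \<and> k \<le> k'"
      then obtain i i' k k' where x: "(i, k) \<in> arcs e (Suc j)" "(i', k') \<in> arcs e (Suc j)"
        "(i, k) \<noteq> (i', k')" "i \<le> i'" "i' < k" "k \<le> k'" by blast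
      \<comment> \<open>In a crossing the second arc ends no earlier than the first, so only the
        second can be the new one.\<close>
      have ik: "(i, k) \<in> arcs e j"
      proof (rule ccontr)
        assume "(i, k) \<notin> arcs e j"
        then have "k = Suc j" "(i', k') \<in> arcs e j" using x by (auto simp: arcs)
        then show False using arc[of i' k'] x(6) by simp
      qed
      show False
      proof (cases "(i', k') \<in> arcs e j")
        case True
        then show ?thesis using no ik x by blast
      next
        case False
        then have "i' = s" using x(2) by (simp add: arcs)
        then show ?thesis using IH(2)[OF s_in ik] x by blast
      qed
    qed
    moreover have "\<not> (i \<le> s' \<and> s' < k)" if "s' \<in> set (stack e (Suc j))" "(i, k) \<in> arcs e (Suc j)" for s' i k
    proof -
      consider "s' = Suc j" | "s' \<in> set (drop ?p (stack e j))" using \<open>s' \<in> _\<close> by auto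
      then show ?thesis
      proof cases
        case 1
        then show ?thesis using arc'[OF that(2)] by simp
      next
        case 2
        then show ?thesis using that(2) below[OF 2] IH(2)[of s' i k] rest by (auto simp: arcs)
      qed
    qed
    ultimately show ?thesis by blast
  qed
qed

text \<open>The arcs allow the stack to be replayed: its entries are distinct, so the left end of
  the arc arriving at \<open>Suc j\<close> reveals how many elements were popped, and a missing arc
  means none.\<close>

lemma arcs_inject:
  assumes e: "subdiagonal_seq n e" and e': "subdiagonal_seq n e'" and eq: "arcs e n = arcs e' n"
  shows "\<forall>k \<in> {1..n}. e k = e' k"
proof -
  have "stack e j = stack e' j \<and> (\<forall>k \<in> {1..j}. e k = e' k)" if "j \<le> n" for j
    using that
  proof (induction j)
    case (Suc j)
    then have stack: "stack e j = stack e' j" and IH: "\<forall>k \<in> {1..j}. e k = e' k" and j: "j < n" by auto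
    have iff: "0 < e (Suc j) \<and> i = stack e j ! (e (Suc j) - 1) \<longleftrightarrow>
        0 < e' (Suc j) \<and> i = stack e j ! (e' (Suc j) - 1)" for i
      using in_arcs_iff[of i j e n] in_arcs_iff[of i j e' n] j unfolding eq stack by simp
    have "e (Suc j) = e' (Suc j)"
    proof (cases "e (Suc j) = 0")
      case True
      then show ?thesis using iff[of "stack e j ! (e' (Suc j) - 1)"] by simp
    next
      case False
      then have "0 < e' (Suc j)" "stack e j ! (e (Suc j) - 1) = stack e j ! (e' (Suc j) - 1)"
        using iff[of "stack e j ! (e (Suc j) - 1)"] False by auto
      moreover have "e (Suc j) \<le> length (stack e j)" "e' (Suc j) \<le> length (stack e j)"
        using pop_le_length_stack[OF e j] pop_le_length_stack[OF e' j] stack by simp_all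
      ultimately have "e (Suc j) - 1 = e' (Suc j) - 1"
        using nth_eq_iff_index_eq[OF distinct_stack, of "e (Suc j) - 1" e j "e' (Suc j) - 1"] False by simp
      then show ?thesis using False \<open>0 < e' (Suc j)\<close> by simp
    qed
    then show ?case using stack IH by (simp add: atLeastAtMostSuc_conv)
  qed simp
  then show ?thesis by blast
qed

lemma subdiagonal_seq_lookup:
  assumes "m \<in> subdiagonal n"
  shows "subdiagonal_seq n (Poly_Mapping.lookup m)"
  unfolding subdiagonal_seq_def
proof
  fix i assume i: "i \<in> {1..n}"
  let ?\<epsilon> = "map (Poly_Mapping.lookup m) [1..<Suc n]"
  have "take i ?\<epsilon> = map (Poly_Mapping.lookup m) [1..<Suc i]"
    unfolding take_map using i by (subst take_upt) auto
  then have "sum_list (take i ?\<epsilon>) = (\<Sum>k = 1..i. Poly_Mapping.lookup m k)"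
    by (simp only: interv_sum_list_conv_sum_set_nat set_upt atLeastLessThanSuc_atLeastAtMost)
  moreover have "length ?\<epsilon> = n" by simp
  then have "\<not> i \<le> sum_list (take i ?\<epsilon>)"
    using assms i unfolding subdiagonal_def transdiagonal_def by (metis (mono_tags, lifting) atLeastAtMost_iff mem_Collect_eq)
  ultimately show "(\<Sum>k = 1..i. Poly_Mapping.lookup m k) < i" by linarith
qed

lemma noncrossing_arcs_lookup: "m \<in> subdiagonal n \<Longrightarrow> noncrossing n (arcs (Poly_Mapping.lookup m) n)"
  using noncrossing_arcs[OF subdiagonal_seq_lookup order.refl] by blast

lemma Q_inject:
  assumes "noncrossing n \<Lambda>" "noncrossing n \<Lambda>'" "Q \<Lambda> = Q \<Lambda>'"
  shows "\<Lambda> = \<Lambda>'"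
  using Q_arc_iff[OF assms(1)] Q_arc_iff[OF assms(2)] assms(3) by auto

lemma inj_on_subdiagonal: "inj_on (\<lambda>m. Q (arcs (Poly_Mapping.lookup m) n)) (subdiagonal n)"
proof (rule inj_onI)
  fix m m' assume m: "m \<in> subdiagonal n" and m': "m' \<in> subdiagonal n"
    and "Q (arcs (Poly_Mapping.lookup m) n) = Q (arcs (Poly_Mapping.lookup m') n)"
  then have "arcs (Poly_Mapping.lookup m) n = arcs (Poly_Mapping.lookup m') n"
    by (intro Q_inject[of n] noncrossing_arcs_lookup)
  then have eq: "\<forall>k \<in> {1..n}. Poly_Mapping.lookup m k = Poly_Mapping.lookup m' k"
    by (rule arcs_inject[OF subdiagonal_seq_lookup[OF m] subdiagonal_seq_lookup[OF m']])
  show "m = m'"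
  proof (rule poly_mapping_eqI)
    fix i
    have "i \<notin> Poly_Mapping.keys m \<and> i \<notin> Poly_Mapping.keys m'" if "i \<notin> {1..n}"
      using that m m' unfolding subdiagonal_def by blast
    then show "Poly_Mapping.lookup m i = Poly_Mapping.lookup m' i"
      using eq by (cases "i \<in> {1..n}") (auto simp: in_keys_iff)
  qed
qed

lemma card_subdiagonal_le: "finite (subdiagonal n)" "card (subdiagonal n) \<le> card (QSV n)"
proof -
  have "(\<lambda>m. Q (arcs (Poly_Mapping.lookup m) n)) ` subdiagonal n \<subseteq> QSV n"
    using noncrossing_arcs_lookup unfolding QSV_def by blast
  then show "finite (subdiagonal n)" "card (subdiagonal n) \<le> card (QSV n)"
    using inj_on_finite[OF inj_on_subdiagonal _ finite_QSV] card_inj_on_le[OF inj_on_subdiagonal _ finite_QSV]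
    by blast+
qed

subsection \<open>Independence of the subdiagonal monomials on \<open>QSV\<^sub>n\<close>\<close>

interpretation fun_space: vector_space "\<lambda>(c::rat) (f :: (nat \<Rightarrow> nat) \<Rightarrow> rat) x. c * f x"
  by standard (auto simp: algebra_simps)

definition vanishes :: "nat \<Rightarrow> mpoly \<Rightarrow> bool" where
  "vanishes n p \<longleftrightarrow> (\<forall>\<sigma> \<in> QSV n. eval (\<lambda>i. of_nat (\<sigma> i)) p = 0)"

lemma vanishing_ideal_eq: "vanishing_ideal n (QSV n) = {p \<in> poly_carrier n. vanishes n p}"
  by (simp add: vanishing_ideal_def vanishes_def R_def)

lemma vanishes_diff: "vanishes n p \<Longrightarrow> vanishes n q \<Longrightarrow> vanishes n (p - q)"
  by (simp add: vanishes_def)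

text \<open>The default 0 off \<open>QSV n\<close> makes equality of functions mean agreement on
  \<open>QSV n\<close>.\<close>

definition point_values :: "nat \<Rightarrow> mpoly \<Rightarrow> (nat \<Rightarrow> nat) \<Rightarrow> rat" where
  "point_values n p \<sigma> = (if \<sigma> \<in> QSV n then eval (\<lambda>i. of_nat (\<sigma> i)) p else 0)"

lemma point_values_eqI: "vanishes n (p - q) \<Longrightarrow> point_values n p = point_values n q"
  by (auto simp: point_values_def vanishes_def)

lemma point_values_span:
  assumes "p \<in> mpoly.span X"
  shows "point_values n p \<in> fun_space.span (point_values n ` X)"
  using assms
proof (induction rule: mpoly.span_induct_alt)
  case base
  have zero: "point_values n 0 = 0" by (auto simp: point_values_def)
  show ?case unfolding zero by (rule fun_space.span_zero)
next
  case (step c x p)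
  have eq: "point_values n (scale c x + p) = (\<lambda>\<sigma>. c * point_values n x \<sigma>) + point_values n p"
    by (auto simp: point_values_def)
  show ?case
    unfolding eq by (intro fun_space.span_add fun_space.span_scale fun_space.span_base imageI step)
qed

lemma QSV_outside: "\<sigma> \<in> QSV n \<Longrightarrow> i \<notin> {1..n} \<Longrightarrow> \<sigma> i = i"
  using Q_outside by (auto simp: QSV_def)

definition delta :: "(nat \<Rightarrow> nat) \<Rightarrow> (nat \<Rightarrow> nat) \<Rightarrow> rat" where
  "delta \<sigma> \<tau> = (if \<tau> = \<sigma> then 1 else 0)"

text \<open>A Lagrange product with one linear factor for each other point, in a coordinate that
  separates the two. This coordinate can be taken in 1, ..., n because all points of
  \<open>QSV n\<close> fix the remaining indices.\<close>

lemma interpolation: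
  assumes \<sigma>: "\<sigma> \<in> QSV n"
  shows "\<exists>p \<in> poly_carrier n. point_values n p = delta \<sigma>"
proof -
  have "\<exists>i \<in> {1..n}. \<sigma> i \<noteq> \<tau> i" if "\<tau> \<in> QSV n - {\<sigma>}" for \<tau>
  proof (rule ccontr)
    assume "\<not> (\<exists>i \<in> {1..n}. \<sigma> i \<noteq> \<tau> i)"
    then have "\<sigma> i = \<tau> i" for i
      using QSV_outside[OF \<sigma>, of i] QSV_outside[of \<tau> n i] that by (cases "i \<in> {1..n}") auto
    then have "\<sigma> = \<tau>" by (rule ext)
    then show False using that by simp
  qed
  then have "\<forall>\<tau> \<in> QSV n - {\<sigma>}. \<exists>i. i \<in> {1..n} \<and> \<sigma> i \<noteq> \<tau> i" by blast
  from bchoice[OF this] obtain i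
    where i: "\<forall>\<tau> \<in> QSV n - {\<sigma>}. i \<tau> \<in> {1..n} \<and> \<sigma> (i \<tau>) \<noteq> \<tau> (i \<tau>)" by blast
  define p where "p = (\<Prod>\<tau> \<in> QSV n - {\<sigma>}.
    scale (1 / (of_nat (\<sigma> (i \<tau>)) - of_nat (\<tau> (i \<tau>)))) (Var (i \<tau>) - of_nat (\<tau> (i \<tau>))))"
  have "p \<in> poly_carrier n"
    unfolding p_def
  proof (rule poly_carrier_prod)
    fix \<tau> assume "\<tau> \<in> QSV n - {\<sigma>}"
    then have "i \<tau> \<in> {1..n}" using i by blast
    then show "scale (1 / (of_nat (\<sigma> (i \<tau>)) - of_nat (\<tau> (i \<tau>)))) (Var (i \<tau>) - of_nat (\<tau> (i \<tau>)))
        \<in> poly_carrier n"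
      by (intro poly_carrier_scale poly_carrier_diff poly_carrier_of_nat poly_carrier_Var)
  qed
  moreover have "point_values n p = delta \<sigma>"
  proof
    fix \<tau> show "point_values n p \<tau> = delta \<sigma> \<tau>"
    proof (cases "\<tau> \<in> QSV n - {\<sigma>}")
      case True
      then have "eval (\<lambda>k. of_nat (\<tau> k)) p = 0"
        unfolding p_def eval_prod
        by (intro prod_zero bexI[OF _ True]) (simp_all add: finite_QSV)
      then show ?thesis using True by (simp add: point_values_def delta_def)
    next
      case False
      have "eval (\<lambda>k. of_nat (\<sigma> k)) p = 1"
        unfolding p_def eval_prod
      proof (rule prod.neutral, rule ballI)
        fix \<tau> assume "\<tau> \<in> QSV n - {\<sigma>}"
        then have "\<sigma> (i \<tau>) \<noteq> \<tau> (i \<tau>)" using i by blast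
        then show "eval (\<lambda>k. of_nat (\<sigma> k))
            (scale (1 / (of_nat (\<sigma> (i \<tau>)) - of_nat (\<tau> (i \<tau>)))) (Var (i \<tau>) - of_nat (\<tau> (i \<tau>)))) = 1"
          by simp
      qed
      then have "point_values n p \<sigma> = 1" using \<sigma> by (simp add: point_values_def)
      then show ?thesis
        using False by (cases "\<tau> = \<sigma>") (simp_all add: point_values_def delta_def)
    qed
  qed
  ultimately show ?thesis by blast
qed

lemma delta_inject: "delta \<sigma> = delta \<tau> \<Longrightarrow> \<sigma> = \<tau>"
  by (drule fun_cong[of _ _ \<sigma>]) (simp add: delta_def split: if_splits)

lemma independent_deltas: "finite S \<Longrightarrow> fun_space.independent (delta ` S)"
proof (induction S rule: finite_induct)
  case (insert \<sigma> S)
  have "fun_space.subspace {f. f \<sigma> = 0}"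
    by (rule fun_space.subspaceI) auto
  then have "fun_space.span (delta ` S) \<subseteq> {f. f \<sigma> = 0}"
    using insert.hyps by (intro fun_space.span_minimal) (auto simp: delta_def)
  moreover have "delta \<sigma> \<sigma> \<noteq> 0" by (simp add: delta_def)
  ultimately have "delta \<sigma> \<notin> fun_space.span (delta ` S)" by blast
  then show ?case
    using insert.IH by (simp add: fun_space.independent_insert)
qed (simp add: fun_space.independent_empty)

lemma keys_in_span:
  assumes "p \<in> mpoly.span (monomial ` X)"
  shows "Poly_Mapping.keys p \<subseteq> X"
  using assms
proof (induction rule: mpoly.span_induct_alt)
  case (step c x p)
  then obtain m where m: "m \<in> X" "x = monomial m" by blast
  have "Poly_Mapping.keys (scale c x) \<subseteq> {m}"
    by (auto simp: m in_keys_iff lookup_scale lookup_single when_def split: if_splits)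
  then show ?case using step m Poly_Mapping.keys_add[of "scale c x" p] by blast
qed simp

text \<open>If \<open>m\<close> occurred in \<open>b\<close>, its values on \<open>QSV n\<close>
  would be a combination of those of the other subdiagonal monomials. These would then still span
  all functions on \<open>QSV n\<close>, although they are fewer than its points.\<close>

lemma vanishing_subdiagonal:
  assumes spanning: "\<And>p. p \<in> poly_carrier n \<Longrightarrow> \<exists>b \<in> mpoly.span (monomial ` subdiagonal n). vanishes n (p - b)"
    and b: "b \<in> mpoly.span (monomial ` subdiagonal n)" "vanishes n b"
  shows "b = 0"
proof (rule ccontr)
  assume "b \<noteq> 0"
  then obtain m where m: "m \<in> Poly_Mapping.keys b" by fastforce
  define X where "X = subdiagonal n - {m}"
  have m_sub: "m \<in> subdiagonal n" using keys_in_span[OF b(1)] m by blast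
  define c where "c = Poly_Mapping.lookup b m"
  have "c \<noteq> 0" using m by (simp add: c_def in_keys_iff)
  \<comment> \<open>Solves \<open>b\<close> for \<open>m\<close>: the term at \<open>m\<close>
    cancels, and \<open>r\<close> takes the values of the monomial on \<open>QSV n\<close> because
    \<open>b\<close> vanishes there.\<close>
  define r where "r = monomial m - scale (1 / c) b"
  have "Poly_Mapping.keys r \<subseteq> X"
  proof
    fix x assume x: "x \<in> Poly_Mapping.keys r"
    then have "x \<noteq> m" using \<open>c \<noteq> 0\<close>
      by (auto simp: r_def in_keys_iff lookup_minus lookup_scale simp flip: c_def)
    then have "x \<in> Poly_Mapping.keys b"
      using x by (auto simp: r_def in_keys_iff lookup_minus lookup_scale lookup_single)
    then show "x \<in> X" using \<open>x \<noteq> m\<close> keys_in_span[OF b(1)] by (auto simp: X_def)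
  qed
  then have "r \<in> mpoly.span (monomial ` X)"
    using mpoly_in_span_monomials[of r] mpoly.span_mono[of "monomial ` Poly_Mapping.keys r" "monomial ` X"] by blast
  then have "point_values n r \<in> fun_space.span (point_values n ` monomial ` X)"
    by (rule point_values_span)
  moreover have "point_values n (monomial m) = point_values n r"
    by (rule point_values_eqI) (use b(2) in \<open>simp add: r_def vanishes_def\<close>)
  ultimately have val_m: "point_values n (monomial m) \<in> fun_space.span (point_values n ` monomial ` X)"
    by simp
  have "point_values n ` monomial ` subdiagonal n \<subseteq> fun_space.span (point_values n ` monomial ` X)"
  proof clarify
    fix x assume "x \<in> subdiagonal n"
    then show "point_values n (monomial x) \<in> fun_space.span (point_values n ` monomial ` X)"
      using val_m by (cases "x = m") (auto simp: X_def intro: fun_space.span_base)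
  qed
  then have sub: "fun_space.span (point_values n ` monomial ` subdiagonal n) \<subseteq> fun_space.span (point_values n ` monomial ` X)"
    by (simp add: fun_space.span_minimal)
  have deltas: "delta ` QSV n \<subseteq> fun_space.span (point_values n ` monomial ` X)"
  proof clarify
    fix \<sigma> assume "\<sigma> \<in> QSV n"
    then obtain p where p: "p \<in> poly_carrier n" "point_values n p = delta \<sigma>" using interpolation by blast
    obtain b' where b': "b' \<in> mpoly.span (monomial ` subdiagonal n)" "vanishes n (p - b')"
      using spanning[OF p(1)] by blast
    have "delta \<sigma> = point_values n b'" using p(2) point_values_eqI[OF b'(2)] by simp
    then show "delta \<sigma> \<in> fun_space.span (point_values n ` monomial ` X)"
      using point_values_span[OF b'(1)] sub by auto
  qed
  have fin: "finite X" using card_subdiagonal_le(1) by (simp add: X_def)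
  then have "finite (point_values n ` monomial ` X)" by simp
  from fun_space.independent_span_bound[OF this independent_deltas[OF finite_QSV] deltas]
  have "card (delta ` QSV n) \<le> card (point_values n ` monomial ` X)" ..
  also have "\<dots> \<le> card X"
    unfolding image_image using fin by (rule card_image_le)
  also have "\<dots> < card (subdiagonal n)"
    unfolding X_def using m_sub card_subdiagonal_le(1) by (rule card_Diff1_less[rotated])
  also have "\<dots> \<le> card (QSV n)" by (rule card_subdiagonal_le)
  also have "\<dots> = card (delta ` QSV n)"
    by (intro card_image[symmetric] inj_onI delta_inject)
  finally show False by simp
qed

subsection \<open>The two ideals\<close>

lemma ideal_subspace:
  assumes "ideal I (R n)"
  shows "mpoly.subspace I"
proof (rule mpoly.subspaceI)
  interpret ideal I "R n" by fact
  show "0 \<in> I" using additive_subgroup.zero_closed[OF is_additive_subgroup] by (simp add: R_def)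
  show "p + q \<in> I" if "p \<in> I" "q \<in> I" for p q using additive_subgroup.a_closed[OF is_additive_subgroup that] by (simp add: R_def)
  show "scale c p \<in> I" if "p \<in> I" for c p
  proof -
    have "Poly_Mapping.single 0 c \<in> carrier (R n)" by (simp add: R_def poly_carrier_def)
    then show ?thesis using I_l_closed[OF that] by (simp add: R_def scale_def)
  qed
qed

lemma ideal_mult:
  assumes "ideal I (R n)" "p \<in> I" "q \<in> poly_carrier n"
  shows "q * p \<in> I"
  using ideal.I_l_closed[OF assms(1,2), of q] assms(3) by (simp add: R_def)

lemma filtered_ideal_subset:
  assumes "ideal I (R n)" "\<And>\<alpha>. composition \<alpha> \<Longrightarrow> \<alpha> \<noteq> [] \<Longrightarrow> length \<alpha> \<le> n \<Longrightarrow> A \<alpha> \<in> I"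
  shows "filtered_ideal n A d \<subseteq> I"
proof
  fix p assume "p \<in> filtered_ideal n A d"
  then show "p \<in> I"
  proof (rule filtered_ideal_induct[OF _ ideal_subspace[OF assms(1)]])
    fix m :: "nat \<Rightarrow>\<^sub>0 nat" and \<alpha>
    assume "Poly_Mapping.keys m \<subseteq> {1..n}" "composition \<alpha>" "\<alpha> \<noteq> []" "length \<alpha> \<le> n"
    then show "monomial m * A \<alpha> \<in> I"
      by (intro ideal_mult[OF assms(1)] assms(2)) (simp_all add: poly_carrier_def)
  qed
qed

lemma ideal_genideal: "S \<subseteq> poly_carrier n \<Longrightarrow> ideal (genideal (R n) S) (R n)"
  using ring.genideal_ideal[OF cring.axioms(1)[OF cring_R]] by (simp add: R_def)

lemma genideal_base: "S \<subseteq> poly_carrier n \<Longrightarrow> x \<in> S \<Longrightarrow> x \<in> genideal (R n) S"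
  by (auto simp: genideal_def)

lemma genideal_least: "ideal I (R n) \<Longrightarrow> S \<subseteq> I \<Longrightarrow> genideal (R n) S \<subseteq> I"
  by (rule ring.genideal_minimal[OF cring.axioms(1)[OF cring_R]])

lemma ideal_vanishing: "ideal (vanishing_ideal n (QSV n)) (R n)"
proof (rule idealI)
  show "ring (R n)" by (rule cring.axioms(1)[OF cring_R])
  have "abelian_group (R n)" using cring.axioms(1)[OF cring_R] by (rule ring.is_abelian_group)
  then interpret abelian_group "R n" .
  have minus: "\<ominus>\<^bsub>R n\<^esub> p = - p" if "p \<in> poly_carrier n" for p
    using that by (intro minus_equality) (simp_all add: R_def poly_carrier_uminus)
  show "subgroup (vanishing_ideal n (QSV n)) (add_monoid (R n))"
  proof (rule add.subgroupI)
    show "vanishing_ideal n (QSV n) \<noteq> {}"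
      by (auto simp: vanishing_ideal_eq vanishes_def intro!: exI[of _ 0] poly_carrier_0)
  qed (auto simp: vanishing_ideal_eq vanishes_def R_def poly_carrier_add poly_carrier_uminus
      a_inv_def[symmetric] minus[unfolded R_def])
qed (auto simp: vanishing_ideal_eq vanishes_def R_def poly_carrier_mult)

lemma P_carrier: "P n \<alpha> \<in> poly_carrier n"
  using P_in_R[of n \<alpha>] by (simp add: R_def)

lemma P_in_vanishing_ideal:
  "composition \<alpha> \<Longrightarrow> \<alpha> \<noteq> [] \<Longrightarrow> P n \<alpha> \<in> vanishing_ideal n (QSV n)"
  by (simp add: vanishing_ideal_eq P_carrier vanishes_def P_vanishes_on_QSV)

text \<open>Substituting P_alpha for M_alpha in each term of a representation of degree at most
  \<open>d\<close> only causes errors below degree \<open>d\<close>.\<close>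

lemma filtered_ideal_M_to_P:
  assumes "q \<in> filtered_ideal n (M n) (Suc d)"
  shows "\<exists>q' \<in> filtered_ideal n (P n) (Suc d). q - q' \<in> deg_lt d"
proof -
  let ?S = "{q. \<exists>q' \<in> filtered_ideal n (P n) (Suc d). q - q' \<in> deg_lt d}"
  have "q \<in> ?S"
    using assms
  proof (rule filtered_ideal_induct)
    show "mpoly.subspace ?S"
    proof (rule mpoly.subspaceI)
      show "0 \<in> ?S" by (auto intro!: bexI[of _ 0] simp: filtered_ideal_0)
    next
      fix p q assume "p \<in> ?S" "q \<in> ?S"
      then obtain p' q' where "p' \<in> filtered_ideal n (P n) (Suc d)" "q' \<in> filtered_ideal n (P n) (Suc d)"
        "p - p' \<in> deg_lt d" "q - q' \<in> deg_lt d" by auto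
      then show "p + q \<in> ?S"
        using deg_lt_add[of "p - p'" d "q - q'"]
        by (auto intro!: bexI[of _ "p' + q'"] simp: filtered_ideal_add algebra_simps)
    next
      fix c q assume "q \<in> ?S"
      then obtain q' where "q' \<in> filtered_ideal n (P n) (Suc d)" "q - q' \<in> deg_lt d" by auto
      then show "scale c q \<in> ?S"
        using deg_lt_scale[of "q - q'" d c]
        by (auto intro!: bexI[of _ "scale c q'"] simp: filtered_ideal_scale mpoly.scale_right_diff_distrib)
    qed
  next
    fix m \<alpha> assume m: "Poly_Mapping.keys m \<subseteq> {1..n}" "composition \<alpha>" "\<alpha> \<noteq> []" "length \<alpha> \<le> n"
      "mon_degree m + sum_list \<alpha> < Suc d"
    have "monomial m * (P n \<alpha> - M n \<alpha>) \<in> deg_lt (mon_degree m + sum_list \<alpha>)"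
      by (intro deg_lt_mult P_minus_M_deg_lt m) simp
    then have "- (monomial m * (P n \<alpha> - M n \<alpha>)) \<in> deg_lt d"
      using m(5) deg_lt_mono[of "mon_degree m + sum_list \<alpha>" d] by (blast intro: deg_lt_uminus less_Suc_eq_le[THEN iffD1])
    then show "monomial m * M n \<alpha> \<in> ?S"
      using filtered_ideal_base[OF m, of "P n"]
      by (auto intro!: bexI[of _ "monomial m * P n \<alpha>"] simp: right_diff_distrib)
  qed
  then show ?thesis by simp
qed

text \<open>Induction on the degree bound: after reduction modulo the \<open>M\<close> and
  substitution of the \<open>P\<close>, the error satisfies a smaller bound.\<close>

lemma in_span_subdiagonal_plus_P:
  assumes "p \<in> poly_carrier n" "p \<in> deg_lt d"
  shows "\<exists>b \<in> mpoly.span (monomial ` subdiagonal_lt n d). p - b \<in> filtered_ideal n (P n) d"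
  using assms
proof (induction d arbitrary: p)
  case 0
  then show ?case by (auto intro!: bexI[of _ 0] simp: mpoly.span_zero filtered_ideal_0)
next
  case (Suc d)
  obtain b where b: "b \<in> mpoly.span (monomial ` subdiagonal_lt n (Suc d))" "p - b \<in> filtered_ideal n (M n) (Suc d)"
    using in_span_subdiagonal_plus[OF Suc.prems] by blast
  obtain q where q: "q \<in> filtered_ideal n (P n) (Suc d)" "p - b - q \<in> deg_lt d"
    using filtered_ideal_M_to_P[OF b(2)] by blast
  have "p - b - q \<in> poly_carrier n"
    using b(2) q(1) filtered_ideal_carrier[of "M n" n "Suc d"] filtered_ideal_carrier[of "P n" n "Suc d"]
    by (auto simp: M_carrier P_carrier intro: poly_carrier_diff)
  then obtain b' where b': "b' \<in> mpoly.span (monomial ` subdiagonal_lt n d)"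
    "p - b - q - b' \<in> filtered_ideal n (P n) d"
    using Suc.IH q(2) by blast
  have "subdiagonal_lt n d \<subseteq> subdiagonal_lt n (Suc d)" by (auto simp: subdiagonal_lt_def)
  then have "b' \<in> mpoly.span (monomial ` subdiagonal_lt n (Suc d))"
    using b'(1) mpoly.span_mono[OF image_mono] by blast
  moreover have "p - b - q - b' \<in> filtered_ideal n (P n) (Suc d)"
    using b'(2) filtered_ideal_mono[of d "Suc d"] by auto
  then have "q + (p - b - q - b') \<in> filtered_ideal n (P n) (Suc d)"
    by (rule filtered_ideal_add[OF q(1)])
  ultimately show ?case
    using b(1) by (intro bexI[of _ "b + b'"]) (auto simp: algebra_simps mpoly.span_add)
qed

lemma ex_deg_lt: "\<exists>d. p \<in> deg_lt d"
proof -
  have "p \<in> deg_lt (Suc (Max (mon_degree ` Poly_Mapping.keys p)))"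
    by (auto simp: deg_lt_def less_Suc_eq_le)
  then show ?thesis by blast
qed

lemma filtered_ideal_P_subset: "filtered_ideal n (P n) d \<subseteq> vanishing_ideal n (QSV n)"
  by (intro filtered_ideal_subset ideal_vanishing P_in_vanishing_ideal)

lemma span_subdiagonal_lt: "mpoly.span (monomial ` subdiagonal_lt n d) \<subseteq> mpoly.span (monomial ` subdiagonal n)"
  by (intro mpoly.span_mono image_mono) (auto simp: subdiagonal_lt_def)

lemma vanishing_span_subdiagonal:
  assumes "b \<in> mpoly.span (monomial ` subdiagonal n)" "vanishes n b"
  shows "b = 0"
proof (rule vanishing_subdiagonal[OF _ assms])
  fix p assume p: "p \<in> poly_carrier n"
  obtain d where "p \<in> deg_lt d" using ex_deg_lt by blast
  then obtain b where "b \<in> mpoly.span (monomial ` subdiagonal_lt n d)" "p - b \<in> filtered_ideal n (P n) d"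
    using in_span_subdiagonal_plus_P[OF p] by blast
  then show "\<exists>b \<in> mpoly.span (monomial ` subdiagonal n). vanishes n (p - b)"
    using span_subdiagonal_lt filtered_ideal_P_subset by (fastforce simp: vanishing_ideal_eq)
qed

lemma genideal_P_eq_vanishing_ideal:
  "genideal (R n) {P n \<alpha> | \<alpha>. composition \<alpha> \<and> \<alpha> \<noteq> [] \<and> length \<alpha> \<le> n} = vanishing_ideal n (QSV n)"
  (is "genideal _ ?G = _")
proof
  show "genideal (R n) ?G \<subseteq> vanishing_ideal n (QSV n)"
    by (rule genideal_least[OF ideal_vanishing]) (auto intro: P_in_vanishing_ideal)
  have G: "?G \<subseteq> poly_carrier n" by (auto simp: P_carrier)
  show "vanishing_ideal n (QSV n) \<subseteq> genideal (R n) ?G"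
  proof
    fix p assume p: "p \<in> vanishing_ideal n (QSV n)"
    obtain d where "p \<in> deg_lt d" using ex_deg_lt by blast
    then obtain b where b: "b \<in> mpoly.span (monomial ` subdiagonal_lt n d)" "p - b \<in> filtered_ideal n (P n) d"
      using in_span_subdiagonal_plus_P[of p] p by (auto simp: vanishing_ideal_eq)
    have "vanishes n (p - b)" using b(2) filtered_ideal_P_subset by (fastforce simp: vanishing_ideal_eq)
    then have "vanishes n b" using p vanishes_diff[of n p "p - b"] by (simp add: vanishing_ideal_eq)
    \<comment> \<open>\<open>p\<close> and \<open>p - b\<close> vanish on \<open>QSV n\<close>,
      hence so does the subdiagonal remainder \<open>b\<close>, and independence applies.\<close>
    then have "b = 0" using vanishing_span_subdiagonal b(1) span_subdiagonal_lt by blast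
    then have "p \<in> filtered_ideal n (P n) d" using b(2) by simp
    moreover have "filtered_ideal n (P n) d \<subseteq> genideal (R n) ?G"
      by (intro filtered_ideal_subset ideal_genideal[OF G] genideal_base[OF G]) blast
    ultimately show "p \<in> genideal (R n) ?G" by blast
  qed
qed

section \<open>The associated graded ideal\<close>

lemma M_homogeneous: "M n \<alpha> \<in> homogeneous (sum_list \<alpha>)"
  by (simp add: M_eq_M_from M_from_homogeneous)

text \<open>The value at the all-ones point counts the index sequences. Were M_alpha zero, the
  leading form of P_alpha would sit in a lower degree.\<close>

lemma M_nonzero:
  assumes "length \<alpha> \<le> n"
  shows "M n \<alpha> \<noteq> 0"
proof -
  have "[1..<Suc (length \<alpha>)] \<in> index_seqs n (length \<alpha>)"
    using assms by (auto simp: index_seqs_def simp del: upt_Suc)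
  then have "card (index_seqs n (length \<alpha>)) \<noteq> 0" using finite_index_seqs by auto
  moreover have "eval (\<lambda>_. 1) (M n \<alpha>) = of_nat (card (index_seqs n (length \<alpha>)))" by (simp add: M_def)
  ultimately show ?thesis by auto
qed

lemma top_component_P:
  assumes "composition \<alpha>" "length \<alpha> \<le> n"
  shows "top_component (P n \<alpha>) = M n \<alpha>"
proof -
  let ?d = "sum_list \<alpha>"
  have less: "P n \<alpha> - M n \<alpha> \<in> deg_lt ?d" using P_minus_M_deg_lt assms by blast
  have P: "P n \<alpha> = M n \<alpha> + (P n \<alpha> - M n \<alpha>)" by simp
  have "hom_component ?d (P n \<alpha>) = M n \<alpha>"
    by (subst P) (simp only: hom_component_add hom_component_homogeneous[OF M_homogeneous]
        hom_component_deg_lt[OF less] add_0_right)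
  moreover have "P n \<alpha> \<in> deg_lt (Suc ?d)"
    using deg_lt_add[OF M_deg_lt, of "P n \<alpha> - M n \<alpha>" \<alpha> n] less deg_lt_mono[of ?d "Suc ?d"] by auto
  ultimately show ?thesis using top_component_eq M_nonzero[OF assms(2)] by metis
qed

lemma top_component_carrier: "p \<in> poly_carrier n \<Longrightarrow> top_component p \<in> poly_carrier n"
  by (simp add: top_component_def hom_component_poly_carrier)

lemma QSym_plus_carrier: "QSym_plus n \<subseteq> poly_carrier n"
  unfolding QSym_plus_def by (rule mpoly.span_minimal[OF _ subspace_poly_carrier]) (auto simp: M_carrier)

text \<open>\<open>b + b'\<close> is the remainder of \<open>p\<close> modulo the \<open>P\<close>
  and therefore zero. As \<open>b'\<close> has degree below \<open>d\<close>, so has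
  \<open>b\<close>, and the part of \<open>p\<close> in degree \<open>d\<close> is that of
  \<open>p - b\<close>.\<close>

lemma top_component_vanishing:
  assumes p: "p \<in> vanishing_ideal n (QSV n)"
  shows "top_component p \<in> genideal (R n) (QSym_plus n)"
proof -
  let ?J = "genideal (R n) (QSym_plus n)"
  have J: "ideal ?J (R n)" by (rule ideal_genideal[OF QSym_plus_carrier])
  have M_in_J: "M n \<alpha> \<in> ?J" if "composition \<alpha>" "\<alpha> \<noteq> []" "length \<alpha> \<le> n" for \<alpha>
    using that by (intro genideal_base[OF QSym_plus_carrier])
      (auto simp: QSym_plus_def intro: mpoly.span_base)
  \<comment> \<open>For \<open>p = 0\<close> this maximum is unspecified, but \<open>p\<close> still
    satisfies the bound and \<open>top_component p\<close> is still the component in degree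
    \<open>d\<close>.\<close>
  define d where "d = Max (mon_degree ` Poly_Mapping.keys p)"
  have "p \<in> deg_lt (Suc d)" by (auto simp: deg_lt_def d_def less_Suc_eq_le)
  then obtain b where b: "b \<in> mpoly.span (monomial ` subdiagonal_lt n (Suc d))"
    "p - b \<in> filtered_ideal n (M n) (Suc d)"
    using in_span_subdiagonal_plus[of p] p by (auto simp: vanishing_ideal_eq)
  obtain q where q: "q \<in> filtered_ideal n (P n) (Suc d)" "p - b - q \<in> deg_lt d"
    using filtered_ideal_M_to_P[OF b(2)] by blast
  have "p - b - q \<in> poly_carrier n"
    using b(2) q(1) filtered_ideal_carrier[of "M n" n "Suc d"] filtered_ideal_carrier[of "P n" n "Suc d"]
    by (auto simp: M_carrier P_carrier intro: poly_carrier_diff)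
  then obtain b' where b': "b' \<in> mpoly.span (monomial ` subdiagonal_lt n d)"
    "p - b - q - b' \<in> filtered_ideal n (P n) d"
    using in_span_subdiagonal_plus_P q(2) by blast
  have v: "vanishes n p" "vanishes n q" "vanishes n (p - b - q - b')"
    using q(1) b'(2) filtered_ideal_P_subset p by (fastforce simp: vanishing_ideal_eq)+
  have "vanishes n (p - q - (p - b - q - b'))" by (rule vanishes_diff[OF vanishes_diff[OF v(1,2)] v(3)])
  moreover have "p - q - (p - b - q - b') = b + b'" by simp
  ultimately have "vanishes n (b + b')" by simp
  moreover have "b + b' \<in> mpoly.span (monomial ` subdiagonal n)"
    using b(1) b'(1) span_subdiagonal_lt by (blast intro: mpoly.span_add)
  ultimately have "b + b' = 0" using vanishing_span_subdiagonal by blast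
  then have "b = - b'" by (simp add: eq_neg_iff_add_eq_0)
  moreover have "b' \<in> deg_lt d"
    using keys_in_span[OF b'(1)] by (auto simp: deg_lt_def subdiagonal_lt_def)
  ultimately have "hom_component d b = 0"
    by (intro hom_component_deg_lt) (simp add: deg_lt_uminus)
  then have "top_component p = hom_component d (p - b)"
    using hom_component_add[of d "p - b" b] by (simp add: top_component_def d_def)
  \<comment> \<open>A monomial times M_alpha is homogeneous, so its component in degree
    \<open>d\<close> is itself or 0, and either lies in the ideal.\<close>
  also have "p - b \<in> {q. hom_component d q \<in> ?J}"
    using b(2)
  proof (rule filtered_ideal_induct)
    show "mpoly.subspace {q. hom_component d q \<in> ?J}"
      using ideal_subspace[OF J]
      by (auto simp: mpoly.subspace_def hom_component_add hom_component_scale)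
    fix m \<alpha> assume m: "Poly_Mapping.keys m \<subseteq> {1..n}" "composition \<alpha>" "\<alpha> \<noteq> []" "length \<alpha> \<le> n"
      "mon_degree m + sum_list \<alpha> < Suc d"
    have mM: "monomial m * M n \<alpha> \<in> homogeneous (mon_degree m + sum_list \<alpha>)"
      by (intro homogeneous_mult M_homogeneous) simp
    have mM_J: "monomial m * M n \<alpha> \<in> ?J"
      using m by (intro ideal_mult[OF J] M_in_J) (simp_all add: poly_carrier_def)
    show "monomial m * M n \<alpha> \<in> {q. hom_component d q \<in> ?J}"
    proof (cases "mon_degree m + sum_list \<alpha> = d")
      case True
      then show ?thesis using mM mM_J hom_component_homogeneous by auto
    next
      case False
      then have "monomial m * M n \<alpha> \<in> deg_lt d"
        using mM m(5) by (auto simp: homogeneous_def deg_lt_def)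
      then show ?thesis
        using mpoly.subspace_0[OF ideal_subspace[OF J]] by (simp add: hom_component_deg_lt)
    qed
  qed
  ultimately show ?thesis by simp
qed

lemma genideal_QSym_plus_eq_gr: "genideal (R n) (QSym_plus n) = gr n (vanishing_ideal n (QSV n))"
proof
  have top: "top_component ` vanishing_ideal n (QSV n) \<subseteq> poly_carrier n"
    by (auto simp: vanishing_ideal_eq top_component_carrier)
  have gr: "ideal (gr n (vanishing_ideal n (QSV n))) (R n)"
    unfolding gr_def by (rule ideal_genideal[OF top])
  have "M n \<alpha> \<in> gr n (vanishing_ideal n (QSV n))" if "composition \<alpha>" "\<alpha> \<noteq> []" "length \<alpha> \<le> n" for \<alpha>
    unfolding gr_def using P_in_vanishing_ideal[of \<alpha> n] top_component_P[of \<alpha> n] that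
    by (intro genideal_base[OF top]) (metis image_eqI)
  then have "QSym_plus n \<subseteq> gr n (vanishing_ideal n (QSV n))"
    unfolding QSym_plus_def by (intro mpoly.span_minimal ideal_subspace[OF gr]) auto
  then show "genideal (R n) (QSym_plus n) \<subseteq> gr n (vanishing_ideal n (QSV n))"
    by (rule genideal_least[OF gr])
  show "gr n (vanishing_ideal n (QSV n)) \<subseteq> genideal (R n) (QSym_plus n)"
    unfolding gr_def
    by (rule genideal_least[OF ideal_genideal[OF QSym_plus_carrier]]) (auto intro: top_component_vanishing)
qed

theorem theorem6p3:
  fixes n :: nat
  shows "genideal (R n) {P n \<alpha> | \<alpha>. composition \<alpha> \<and> \<alpha> \<noteq> [] \<and> length \<alpha> \<le> n}
           = vanishing_ideal n (QSV n) \<and>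
         genideal (R n) (QSym_plus n) = gr n (vanishing_ideal n (QSV n))"
  using genideal_P_eq_vanishing_ideal genideal_QSym_plus_eq_gr by blast

end
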